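(* Consider a stochastic saddle-point problem in the $\ell_1$ setting (as in the context). Let $(x^t,y^t)_{t\in[T]}$ be the iterates of Algorithm A (described in the context), let $(\tilde x,\tilde y)=\frac1T\sum_{t=1}^T(\tilde x^t,\tilde y^t)$ be its output, where the $(\tilde x^t,\tilde y^t)\sim P_{x^t}\times P_{y^t}$ are drawn independently, and let $\bar x=\frac1T\sum_{t\in[T]}x^t$, $\bar y=\frac1T\sum_{t\in[T]}y^t$. Then $$\mathbb E[\operatorname{Gap}(\tilde x,\tilde y)-\operatorname{Gap}(\bar x,\bar y)]\le\frac{4L_1}{T}+\frac{2L_1\sqrt\ell}{\sqrt T}.$$
   Context: **Smoothness.** A differentiable $F$ is $L_0$-Lipschitz w.r.t. $\|\cdot\|_1$ over a set if $\|\nabla F\|_\infty\le L_0$ there; it is $L_1$-smooth w.r.t. $\|\cdot\|_1$ over the set if $\|\nabla F(u)-\nabla F(u')\|_\infty\le L_1\|u-u'\|_1$ for all $u,u'$ in it. **SSP problem in the $\ell_1$ setting.** $\Delta_x\subset\mathbb R^{d_x}$, $\Delta_y\subset\mathbb R^{d_y}$ are the standard simplices, $\mathcal D$ is a distribution on $\mathcal Z$, and for each $z\in\mathcal Z$ the function $(x,y)\mapsto f(x,y;z)$ is convex in $x$, concave in $y$, and $L_0$-Lipschitz and $L_1$-smooth w.r.t. $\|\cdot\|_1$ (in $(x,y)\in\mathbb R^{d_x+d_y}$, over $\Delta_x\times\Delta_y$). $F_{\mathcal D}(x,y)=\mathbb E_{z\sim\mathcal D}[f(x,y;z)]$, $\ell=\log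 d_x+\log d_y$, $\operatorname{Gap}(x,y)=\max_{v\in\Delta_x,w\in\Delta_y}\big(F_{\mathcal D}(x,w)-F_{\mathcal D}(v,y)\big)$. For a batch $B$, $\nabla F_{\mathcal D}(x,y;B)=\frac1{|B|}\sum_{z\in B}\nabla f(x,y;z)$. For $x$ in a simplex, $P_x$ is the distribution of the random canonical vector equal to $e_i$ with probability $x_i$. **Algorithm A (inputs: dataset $S$ of size $n$, steps $T$, step-size $\tau>0$, number of samples $K$).** Set $x^1=(1/d_x,\dots,1/d_x)$, $y^1=(1/d_y,\dots,1/d_y)$. For $t=1,\dots,T$: draw $(\hat x^{t,k},\hat y^{t,k})_{k\in[K]}$ i.i.d. from $P_{x^t}\times P_{y^t}$ and let $(\hat x^t,\hat y^t)$ be their average; let $B^t$ be a batch of $B=n/T$ fresh samples from $S$; set $g^t_x=\nabla_xF_{\mathcal D}(\hat x^t,\hat y^t;B^t)$, $g^t_y=-\nabla_yF_{\mathcal D}(\hat x^t,\hat y^t;B^t)$; update $x^{t+1}_j\propto x^t_j\exp(-\tau g^t_{x,j})$ and $y^{t+1}_i\propto y^t_i\exp(-\tau g^t_{y,i})$. Return $(\tilde x,\tilde y)=\frac1T\sum_{t=1}^T(\tilde x^t,\tilde y^t)$, where, conditionally on all the iterates, the $(\tilde x^t,\tilde y^t)\sim P_{x^t}\times P_{y^t}$ are independent. *)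

theory Defs
  imports "HOL-Probability.Probability"
begin

definition l1norm :: "'a::euclidean_space \<Rightarrow> real" where
  "l1norm u = (\<Sum>b\<in>Basis. \<bar>u \<bullet> b\<bar>)"

text \<open>The full Euclidean gradient; meaningful only where the function is differentiable.\<close>

definition grad :: "('a::euclidean_space \<Rightarrow> real) \<Rightarrow> 'a \<Rightarrow> 'a" where
  "grad F u = (THE D. GDERIV F u :> D)"

text \<open>
  On a product of coordinate spaces, \<open>Basis\<close> is the joint standard basis, so \<open>l1norm\<close> and
  \<^const>\<open>infnorm\<close> are the usual norms of the concatenated vector. As in \<^const>\<open>lipschitz_on\<close>, the
  constants are required to be nonnegative (on a one-point set this is not automatic).
\<close>

definition l1_lipschitz :: "real \<Rightarrow> ('a::euclidean_space \<Rightarrow> real) \<Rightarrow> 'a set \<Rightarrow> bool" where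
  "l1_lipschitz L F A \<longleftrightarrow> 0 \<le> L \<and> (\<forall>u\<in>A. F differentiable (at u) \<and> infnorm (grad F u) \<le> L)"

definition l1_smooth :: "real \<Rightarrow> ('a::euclidean_space \<Rightarrow> real) \<Rightarrow> 'a set \<Rightarrow> bool" where
  "l1_smooth L F A \<longleftrightarrow> 0 \<le> L \<and> (\<forall>u\<in>A. F differentiable (at u)) \<and>
     (\<forall>u\<in>A. \<forall>u'\<in>A. infnorm (grad F u - grad F u') \<le> L * l1norm (u - u'))"

definition prob_simplex :: "(real ^ 'n) set" where
  "prob_simplex = {x. (\<forall>i. 0 \<le> x $ i) \<and> (\<Sum>i\<in>UNIV. x $ i) = 1}"

definition pop_obj :: "'z measure \<Rightarrow> ('a \<Rightarrow> 'z \<Rightarrow> real) \<Rightarrow> 'a \<Rightarrow> real" where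
  "pop_obj D f p = (\<integral>z. f p z \<partial>D)"

text \<open>
  The maximum over \<open>\<Delta>\<^sub>x \<times> \<Delta>\<^sub>y\<close> is written as a supremum; it is attained whenever the objective is
  continuous on the product of the simplices.
\<close>

definition Gap :: "((real ^ 'n) \<times> (real ^ 'm) \<Rightarrow> real) \<Rightarrow> (real ^ 'n) \<times> (real ^ 'm) \<Rightarrow> real" where
  "Gap F p = (SUP (v, w) \<in> prob_simplex \<times> prob_simplex. F (fst p, w) - F (v, snd p))"

definition batch_grad ::
  "('a::euclidean_space \<Rightarrow> 'z \<Rightarrow> real) \<Rightarrow> (nat \<Rightarrow> 'z) \<Rightarrow> nat set \<Rightarrow> 'a \<Rightarrow> 'a" where
  "batch_grad f S I p = (1 / real (card I)) *\<^sub>R (\<Sum>i\<in>I. grad (\<lambda>q. f q (S i)) p)"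

text \<open>The distribution \<open>P\<^sub>x\<close>. The weights form a mass function exactly when \<open>x\<close> is in the simplex.\<close>

definition vertex_pmf :: "real ^ 'n \<Rightarrow> (real ^ 'n) pmf" where
  "vertex_pmf x = map_pmf (\<lambda>i. axis i 1) (embed_pmf (\<lambda>i. x $ i))"

definition vertex_pair_pmf :: "(real ^ 'n) \<times> (real ^ 'm) \<Rightarrow> ((real ^ 'n) \<times> (real ^ 'm)) pmf" where
  "vertex_pair_pmf p = pair_pmf (vertex_pmf (fst p)) (vertex_pmf (snd p))"

text \<open>\<open>avg N u\<close> is the average of \<open>u 1, \<dots>, u N\<close>.\<close>

definition avg :: "nat \<Rightarrow> (nat \<Rightarrow> 'a::real_vector) \<Rightarrow> 'a" where
  "avg N u = (1 / real N) *\<^sub>R (\<Sum>t\<in>{1..N}. u t)"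

definition mw_update :: "real \<Rightarrow> real ^ 'n \<Rightarrow> real ^ 'n \<Rightarrow> real ^ 'n" where
  "mw_update \<tau> x g =
     (\<chi> j. x $ j * exp (- \<tau> * g $ j) / (\<Sum>i\<in>UNIV. x $ i * exp (- \<tau> * g $ i)))"

definition uniform_start :: "(real ^ 'n) \<times> (real ^ 'm)" where
  "uniform_start = (\<chi> j. 1 / real CARD('n), \<chi> i. 1 / real CARD('m))"

definition alg_step ::
  "((real ^ 'n) \<times> (real ^ 'm) \<Rightarrow> 'z \<Rightarrow> real) \<Rightarrow> (nat \<Rightarrow> 'z) \<Rightarrow> nat set \<Rightarrow> real \<Rightarrow> nat
    \<Rightarrow> (real ^ 'n) \<times> (real ^ 'm) \<Rightarrow> ((real ^ 'n) \<times> (real ^ 'm)) pmf" where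
  "alg_step f S I \<tau> K p =
     do {
       h \<leftarrow> Pi_pmf {1..K} 0 (\<lambda>_. vertex_pair_pmf p);
       let G = batch_grad f S I (avg K h);
       return_pmf (mw_update \<tau> (fst p) (fst G), mw_update \<tau> (snd p) (- snd G))
     }"

text \<open>
  Joint law of the iterates after \<open>T\<close> rounds: position \<open>t\<close> of the random sequence holds
  \<open>(x\<^sup>t, y\<^sup>t)\<close> for \<open>1 \<le> t \<le> T + 1\<close>; the other positions are dummies. The batch used in round
  \<open>t\<close> consists of the data points with indices in \<open>\<beta> t\<close>.
\<close>

primrec alg_iterates ::
  "((real ^ 'n) \<times> (real ^ 'm) \<Rightarrow> 'z \<Rightarrow> real) \<Rightarrow> (nat \<Rightarrow> 'z) \<Rightarrow> (nat \<Rightarrow> nat set) \<Rightarrow> real \<Rightarrow> nat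
    \<Rightarrow> nat \<Rightarrow> (nat \<Rightarrow> (real ^ 'n) \<times> (real ^ 'm)) pmf" where
  "alg_iterates f S \<beta> \<tau> K 0 = return_pmf (\<lambda>_. uniform_start)"
| "alg_iterates f S \<beta> \<tau> K (Suc t) =
     do {
       p \<leftarrow> alg_iterates f S \<beta> \<tau> K t;
       q \<leftarrow> alg_step f S (\<beta> (Suc t)) \<tau> K (p (Suc t));
       return_pmf (p(Suc (Suc t) := q))
     }"

text \<open>
  Joint law of the iterates and the output-phase vertices \<open>r t = (x~\<^sup>t, y~\<^sup>t)\<close>, which are
  independent given the iterates; the returned point is \<open>avg T r\<close>.
\<close>

definition alg_run ::
  "((real ^ 'n) \<times> (real ^ 'm) \<Rightarrow> 'z \<Rightarrow> real) \<Rightarrow> (nat \<Rightarrow> 'z) \<Rightarrow> (nat \<Rightarrow> nat set) \<Rightarrow> real \<Rightarrow> nat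
    \<Rightarrow> nat \<Rightarrow> ((nat \<Rightarrow> (real ^ 'n) \<times> (real ^ 'm)) \<times> (nat \<Rightarrow> (real ^ 'n) \<times> (real ^ 'm))) pmf" where
  "alg_run f S \<beta> \<tau> K T =
     do {
       p \<leftarrow> alg_iterates f S \<beta> \<tau> K T;
       r \<leftarrow> Pi_pmf {1..T} 0 (\<lambda>t. vertex_pair_pmf (p t));
       return_pmf (p, r)
     }"

end

theory Submission
  imports Defs
begin

text \<open>
  For fixed iterates, \<open>Gap\<close> splits into \<open>max\<^sub>w F (x, w)\<close> and \<open>max\<^sub>v - F (v, y)\<close>, which are treated
  alike. Let \<open>w\<^sub>0\<close> maximize \<open>w \<mapsto> E F (x~, w)\<close>. Concavity at \<open>w\<^sub>0\<close> gives
  \<open>max\<^sub>w F (x~, w) \<le> F (x~, w\<^sub>0) + max\<^sub>w \<langle>\<nabla>\<^sub>y F (x~, w\<^sub>0), w - w\<^sub>0\<rangle>\<close>, and by optimality of \<open>w\<^sub>0\<close> the gradient may be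
  replaced by its deviation from its mean. Each coordinate of the gradient moves by at most \<open>2 L\<^sub>1 / T\<close>
  when one of the \<open>T\<close> vertices is resampled, so these deviations are sub-Gaussian with variance proxy
  \<open>L\<^sub>1\<^sup>2 / T\<close> by McDiarmid's argument, and the expected maximum over the coordinates is at most
  \<open>L\<^sub>1 sqrt (2 ln d / T)\<close>. The remaining term \<open>E F (x~, w\<^sub>0) - F (x-bar, w\<^sub>0)\<close> is at most \<open>2 L\<^sub>1 / T\<close>:
  the vertices are replaced by their means one at a time, each costing only the quadratic error of a
  step of length \<open>2 / T\<close>.
\<close>

section \<open>Finitely supported distributions\<close>

text \<open>Finite support makes every integrand integrable, so the tower rule needs no boundedness
  condition. All randomness of the algorithm is of this kind.\<close>

lemma expectation_bind_finite_pmf: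
  fixes h :: "'b \<Rightarrow> 'c::{banach, second_countable_topology}"
  assumes "finite (set_pmf p)" "\<And>x. x \<in> set_pmf p \<Longrightarrow> finite (set_pmf (g x))"
  shows "measure_pmf.expectation (p \<bind> g) h =
    measure_pmf.expectation p (\<lambda>x. measure_pmf.expectation (g x) h)"
  using assms
  by (subst pmf_expectation_bind[where A = "set_pmf p"])
     (auto simp: integral_measure_pmf[where A = "set_pmf p"])

lemma expectation_mono_finite_pmf:
  fixes g h :: "'a \<Rightarrow> real"
  assumes "finite (set_pmf p)" "\<And>x. x \<in> set_pmf p \<Longrightarrow> g x \<le> h x"
  shows "measure_pmf.expectation p g \<le> measure_pmf.expectation p h"
  using assms by (intro integral_mono_AE integrable_measure_pmf_finite) (auto simp: AE_measure_pmf_iff)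

lemma expectation_cong_pmf:
  fixes g h :: "'a \<Rightarrow> 'b::{banach, second_countable_topology}"
  assumes "\<And>x. x \<in> set_pmf p \<Longrightarrow> g x = h x"
  shows "measure_pmf.expectation p g = measure_pmf.expectation p h"
  using assms by (intro integral_cong_AE) (auto simp: AE_measure_pmf_iff)

lemma finite_set_Pi_pmf:
  assumes "finite A" "\<And>i. i \<in> A \<Longrightarrow> finite (set_pmf (p i))"
  shows "finite (set_pmf (Pi_pmf A d p))"
  using assms by (auto simp: set_Pi_pmf)

text \<open>Separates one independent coordinate from the others. The inductions in
  \<open>mcdiarmid_mgf\<close> and \<open>expectation_smooth_avg_le\<close> both rest on it.\<close>

lemma expectation_Pi_pmf_insert:
  fixes h :: "('a \<Rightarrow> 'b) \<Rightarrow> 'c::{banach, second_countable_topology}"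
  assumes "finite A" "i \<notin> A" "\<And>j. j \<in> insert i A \<Longrightarrow> finite (set_pmf (p j))"
  shows "measure_pmf.expectation (Pi_pmf (insert i A) d p) h =
    measure_pmf.expectation (p i) (\<lambda>y. measure_pmf.expectation (Pi_pmf A d p) (\<lambda>r. h (r(i := y))))"
  using assms
  by (simp add: Pi_pmf_insert' expectation_bind_finite_pmf finite_set_Pi_pmf)

section \<open>Exponential moments and expected maxima\<close>

lemma hoeffding_finite_pmf:
  fixes g :: "'a \<Rightarrow> real"
  assumes fin: "finite (set_pmf p)" and l: "0 < l"
    and c: "\<And>a b. a \<in> set_pmf p \<Longrightarrow> b \<in> set_pmf p \<Longrightarrow> g a - g b \<le> c"
  shows "measure_pmf.expectation p (\<lambda>x. exp (l * (g x - measure_pmf.expectation p g)))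
    \<le> exp (l\<^sup>2 * c\<^sup>2 / 8)"
proof -
  \<comment> \<open>The hypothesis bounds only the oscillation of \<open>g\<close>. The minimum over
    the finite support is the left end of an interval of length \<open>c\<close>, as Hoeffding's
    lemma requires.\<close>
  define m where "m = Min (g ` set_pmf p)"
  have m: "m \<in> g ` set_pmf p"
    unfolding m_def using fin by (intro Min_in) (auto simp: set_pmf_not_empty)
  have "m \<le> g x \<and> g x \<le> m + c" if "x \<in> set_pmf p" for x
  proof
    show "m \<le> g x" unfolding m_def using fin that by auto
    show "g x \<le> m + c" using m c[OF that] by (auto simp: algebra_simps)
  qed
  then interpret interval_bounded_random_variable "measure_pmf p" g m "m + c"
    by unfold_locales (auto simp: AE_measure_pmf_iff)
  have "ennreal (measure_pmf.expectation p (\<lambda>x. exp (l * (g x - measure_pmf.expectation p g))))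
    \<le> ennreal (exp (l\<^sup>2 * c\<^sup>2 / 8))"
    using Hoeffdings_lemma_nn_integral[OF l]
    by (subst nn_integral_eq_integral[symmetric])
       (auto intro!: integrable_measure_pmf_finite fin)
  thus ?thesis by simp
qed

text \<open>Given the value \<open>y\<close> of coordinate \<open>i\<close>, the deviation of
  \<open>h\<close> splits into \<open>h (r(i := y)) - h1 y\<close>, handled by the induction
  hypothesis, and \<open>h1 y - \<mu>\<close>, handled by Hoeffding's lemma because the partial mean
  \<open>h1\<close> inherits the oscillation \<open>c i\<close>. The exponents add up. Differences
  are bounded only on the supports, since in the application the average lies in the simplex only
  there.\<close>

lemma mcdiarmid_mgf:
  fixes h :: "('a \<Rightarrow> 'b) \<Rightarrow> real"
  assumes "finite A" and l: "0 < l"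
    and fin: "\<And>i. i \<in> A \<Longrightarrow> finite (set_pmf (p i))"
    and "\<And>r i a b. (\<And>j. j \<in> A \<Longrightarrow> r j \<in> set_pmf (p j)) \<Longrightarrow> i \<in> A \<Longrightarrow>
      a \<in> set_pmf (p i) \<Longrightarrow> b \<in> set_pmf (p i) \<Longrightarrow> h (r(i := a)) - h (r(i := b)) \<le> c i"
  shows "measure_pmf.expectation (Pi_pmf A d p)
      (\<lambda>r. exp (l * (h r - measure_pmf.expectation (Pi_pmf A d p) h)))
    \<le> exp (l\<^sup>2 * (\<Sum>i\<in>A. (c i)\<^sup>2) / 8)"
  using assms(1,3-)
proof (induction A arbitrary: h rule: finite_induct)
  case empty
  then show ?case by simp
next
  case (insert i A)
  let ?E = "measure_pmf.expectation (Pi_pmf A d p)"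
  define h1 where "h1 y = ?E (\<lambda>r. h (r(i := y)))" for y
  define \<mu> where "\<mu> = measure_pmf.expectation (p i) h1"
  have finA: "finite (set_pmf (Pi_pmf A d p))"
    using insert by (intro finite_set_Pi_pmf) auto
  have fini: "finite (set_pmf (p i))" using insert by auto
  have supp: "r j \<in> set_pmf (p j)" if "r \<in> set_pmf (Pi_pmf A d p)" "j \<in> A" for r j
    using that insert(1) by (auto simp: set_Pi_pmf PiE_dflt_def)
  have IH: "?E (\<lambda>r. exp (l * (h (r(i := y)) - h1 y))) \<le> exp (l\<^sup>2 * (\<Sum>i\<in>A. (c i)\<^sup>2) / 8)"
    if y: "y \<in> set_pmf (p i)" for y
    unfolding h1_def
  proof (rule insert.IH)
    fix r j a b assume r: "\<And>j. j \<in> A \<Longrightarrow> r j \<in> set_pmf (p j)" and j: "j \<in> A"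
      and ab: "a \<in> set_pmf (p j)" "b \<in> set_pmf (p j)"
    have "h ((r(i := y))(j := a)) - h ((r(i := y))(j := b)) \<le> c j"
      using r j ab y by (intro insert.prems(2)) auto
    moreover have "j \<noteq> i" using j insert by auto
    ultimately show "h (r(j := a, i := y)) - h (r(j := b, i := y)) \<le> c j"
      by (simp add: fun_upd_twist)
  qed (use insert in auto)
  have "h1 a - h1 b \<le> c i" if ab: "a \<in> set_pmf (p i)" "b \<in> set_pmf (p i)" for a b
  proof -
    have "h1 a - h1 b = ?E (\<lambda>r. h (r(i := a)) - h (r(i := b)))"
      unfolding h1_def by (subst Bochner_Integration.integral_diff)
        (auto intro: integrable_measure_pmf_finite finA)
    also have "\<dots> \<le> ?E (\<lambda>r. c i)"
    proof (rule expectation_mono_finite_pmf[OF finA])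
      fix r assume r: "r \<in> set_pmf (Pi_pmf A d p)"
      \<comment> \<open>A sample \<open>r\<close> over \<open>A\<close> has the default
        \<open>d\<close> at \<open>i\<close>, which may lie outside the support. The hypothesis is
        therefore applied at \<open>r(i := a)\<close>, and the repeated update collapses.\<close>
      have "h ((r(i := a))(i := a)) - h ((r(i := a))(i := b)) \<le> c i"
        using ab supp[OF r] insert(2) by (intro insert.prems(2)) auto
      thus "h (r(i := a)) - h (r(i := b)) \<le> c i" by simp
    qed
    finally show ?thesis by simp
  qed
  hence hoeff: "measure_pmf.expectation (p i) (\<lambda>y. exp (l * (h1 y - \<mu>))) \<le> exp (l\<^sup>2 * (c i)\<^sup>2 / 8)"
    unfolding \<mu>_def by (intro hoeffding_finite_pmf fini l)
  have ins: "measure_pmf.expectation (Pi_pmf (insert i A) d p) k =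
      measure_pmf.expectation (p i) (\<lambda>y. ?E (\<lambda>r. k (r(i := y))))" for k :: "('a \<Rightarrow> 'b) \<Rightarrow> real"
    using insert by (intro expectation_Pi_pmf_insert) auto
  have \<mu>: "measure_pmf.expectation (Pi_pmf (insert i A) d p) h = \<mu>"
    by (simp add: ins \<mu>_def h1_def[abs_def])
  have "measure_pmf.expectation (Pi_pmf (insert i A) d p) (\<lambda>r. exp (l * (h r - \<mu>)))
    = measure_pmf.expectation (p i)
        (\<lambda>y. exp (l * (h1 y - \<mu>)) * ?E (\<lambda>r. exp (l * (h (r(i := y)) - h1 y))))"
    unfolding ins
    by (subst integral_mult_right_zero[symmetric]) (simp add: mult_exp_exp algebra_simps)
  also have "\<dots> \<le> measure_pmf.expectation (p i)
      (\<lambda>y. exp (l * (h1 y - \<mu>)) * exp (l\<^sup>2 * (\<Sum>i\<in>A. (c i)\<^sup>2) / 8))"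
    by (intro expectation_mono_finite_pmf fini mult_left_mono IH) auto
  also have "\<dots> \<le> exp (l\<^sup>2 * (c i)\<^sup>2 / 8) * exp (l\<^sup>2 * (\<Sum>i\<in>A. (c i)\<^sup>2) / 8)"
    using hoeff by simp
  also have "\<dots> = exp (l\<^sup>2 * (\<Sum>i\<in>insert i A. (c i)\<^sup>2) / 8)"
    using insert(1,2) by (simp add: mult_exp_exp algebra_simps add_divide_distrib)
  finally show ?case by (simp add: \<mu>)
qed

text \<open>The optimization over \<open>l\<close> that ends a Chernoff argument. For positive
  \<open>B\<close>, the choice \<open>l = a / (2 * B)\<close> turns the second term into
  \<open>a / 2\<close> and avoids roots of a quotient.\<close>

lemma le_two_sqrt_mult:
  fixes a A B :: real
  assumes "0 \<le> A" "0 \<le> B" and le: "\<And>l. 0 < l \<Longrightarrow> a \<le> A / l + l * B"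
  shows "a \<le> 2 * sqrt (A * B)"
proof (cases "a \<le> 0")
  case True
  moreover have "0 \<le> sqrt (A * B)" using assms by simp
  ultimately show ?thesis by linarith
next
  case False
  hence a: "a > 0" by simp
  show ?thesis
  proof (cases "B = 0")
    case True
    \<comment> \<open>With \<open>B = 0\<close> any sufficiently large \<open>l\<close> contradicts
      \<open>a > 0\<close>; this one makes \<open>A / l\<close> less than \<open>a\<close>.\<close>
    have "a \<le> A / ((2 * A + 1) / a)" using le[of "(2 * A + 1) / a"] a assms True by simp
    hence "a * (2 * A + 1) \<le> a * A" using assms by (simp add: field_simps)
    hence False using a assms by simp
    thus ?thesis ..
  next
    case False
    hence B: "B > 0" using assms by simp
    have "a \<le> A / (a / (2 * B)) + a / (2 * B) * B" using le[of "a / (2 * B)"] a B by simp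
    hence "a\<^sup>2 \<le> 4 * (A * B)" using a B by (simp add: field_simps power2_eq_square)
    hence "sqrt (a\<^sup>2) \<le> sqrt (4 * (A * B))" by (rule real_sqrt_le_mono)
    thus ?thesis using a by (simp add: real_sqrt_mult)
  qed
qed

text \<open>Exponentiate, bound the exponential of the maximum by the sum of the exponentials, take
  logarithms, and optimize over \<open>l\<close>.\<close>

lemma expectation_Max_subgaussian:
  fixes X :: "'i::finite \<Rightarrow> 'a \<Rightarrow> real"
  assumes fin: "finite (set_pmf p)" and v: "0 \<le> v"
    and mgf: "\<And>j l. 0 < l \<Longrightarrow> measure_pmf.expectation p (\<lambda>x. exp (l * X j x)) \<le> exp (l\<^sup>2 * v / 2)"
  shows "measure_pmf.expectation p (\<lambda>x. Max (range (\<lambda>j. X j x))) \<le> sqrt (2 * v * ln (real CARD('i)))"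
proof -
  let ?M = "\<lambda>x. Max (range (\<lambda>j. X j x))"
  let ?E = "measure_pmf.expectation p"
  have int: "integrable (measure_pmf p) g" for g :: "'a \<Rightarrow> real"
    by (rule integrable_measure_pmf_finite[OF fin])
  have "?E ?M \<le> ln (real CARD('i)) / l + l * (v / 2)" if l: "0 < l" for l
  proof -
    define m where "m = ?E ?M"
    \<comment> \<open>Jensen's inequality by hand: the tangent of the exponential at the mean has
      expectation \<open>exp (l * m)\<close> and lies below the exponential.\<close>
    have "exp (l * m) = ?E (\<lambda>x. exp (l * m) * (1 + l * (?M x - m)))"
      by (simp add: int m_def)
    also have "\<dots> \<le> ?E (\<lambda>x. exp (l * ?M x))"
    proof (rule expectation_mono_finite_pmf[OF fin])
      fix x
      have "exp (l * m) * (1 + l * (?M x - m)) \<le> exp (l * m) * exp (l * (?M x - m))"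
        by (intro mult_left_mono exp_ge_add_one_self) auto
      thus "exp (l * m) * (1 + l * (?M x - m)) \<le> exp (l * ?M x)"
        by (simp add: mult_exp_exp algebra_simps)
    qed
    also have "\<dots> \<le> ?E (\<lambda>x. \<Sum>j\<in>UNIV. exp (l * X j x))"
    proof (rule expectation_mono_finite_pmf[OF fin])
      fix x
      have "?M x \<in> range (\<lambda>j. X j x)" by (intro Max_in) auto
      then obtain j where "?M x = X j x" by (rule rangeE)
      thus "exp (l * ?M x) \<le> (\<Sum>j\<in>UNIV. exp (l * X j x))"
        by (simp add: member_le_sum[where f = "\<lambda>j. exp (l * X j x)"])
    qed
    also have "\<dots> = (\<Sum>j\<in>UNIV. ?E (\<lambda>x. exp (l * X j x)))"
      by (rule Bochner_Integration.integral_sum) (rule int)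
    also have "\<dots> \<le> (\<Sum>j\<in>(UNIV::'i set). exp (l\<^sup>2 * v / 2))"
      by (intro sum_mono mgf l)
    also have "\<dots> = exp (ln (real CARD('i)) + l\<^sup>2 * v / 2)"
      by (simp add: exp_add)
    finally have "l * m \<le> ln (real CARD('i)) + l\<^sup>2 * v / 2" by simp
    thus ?thesis using l unfolding m_def[symmetric] by (simp add: field_simps power2_eq_square)
  qed
  hence "?E ?M \<le> 2 * sqrt (ln (real CARD('i)) * (v / 2))"
    by (intro le_two_sqrt_mult) (use v in auto)
  also have "\<dots> = sqrt (4 * (ln (real CARD('i)) * (v / 2)))" by (subst real_sqrt_mult) simp
  finally show ?thesis by (simp add: algebra_simps)
qed

section \<open>The l1 norm, the simplex and averages of vertices\<close>

lemma l1norm_vec: "l1norm (x :: real ^ 'n) = (\<Sum>i\<in>UNIV. \<bar>x $ i\<bar>)"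
proof -
  have B: "Basis = range (\<lambda>i::'n. axis i (1::real))" by (auto simp: Basis_vec_def)
  have inj: "inj (\<lambda>i::'n. axis i (1::real))" by (auto simp: inj_on_def axis_eq_axis)
  have "l1norm x = (\<Sum>i\<in>UNIV. \<bar>x \<bullet> axis i 1\<bar>)"
    unfolding l1norm_def B by (subst sum.reindex[OF inj]) simp
  thus ?thesis by (simp add: inner_axis)
qed

lemma l1norm_nonneg: "0 \<le> l1norm u"
  by (auto simp: l1norm_def intro: sum_nonneg)

lemma l1norm_scaleR: "l1norm (c *\<^sub>R u) = \<bar>c\<bar> * l1norm u"
  by (simp add: l1norm_def abs_mult sum_distrib_left)

lemma l1norm_minus_commute: "l1norm (u - v) = l1norm (v - u)"
  by (simp add: l1norm_def inner_diff_left abs_minus_commute)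

lemma l1norm_le_norm: "l1norm (u :: 'a::euclidean_space) \<le> real DIM('a) * norm u"
  unfolding l1norm_def by (rule sum_bounded_above) (rule Basis_le_norm)

lemma l1norm_Pair: "l1norm (u, v) = l1norm u + l1norm v"
proof -
  have "l1norm (u, v) = (\<Sum>b\<in>(\<lambda>i. (i, 0)) ` Basis. \<bar>(u, v) \<bullet> b\<bar>)
      + (\<Sum>b\<in>(\<lambda>j. (0, j)) ` Basis. \<bar>(u, v) \<bullet> b\<bar>)"
    unfolding l1norm_def Basis_prod_def by (intro sum.union_disjoint) auto
  thus ?thesis by (simp add: sum.reindex inj_on_def l1norm_def)
qed

lemma l1norm_zero [simp]: "l1norm 0 = 0"
  by (simp add: l1norm_def)

text \<open>Hoelder's inequality for this pair of dual norms.\<close>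

lemma inner_le_infnorm_l1norm: "\<bar>u \<bullet> v\<bar> \<le> infnorm u * l1norm v"
proof -
  have "u \<bullet> v = (\<Sum>b\<in>Basis. (u \<bullet> b) * (v \<bullet> b))" by (rule euclidean_inner)
  also have "\<bar>\<dots>\<bar> \<le> (\<Sum>b\<in>Basis. \<bar>(u \<bullet> b) * (v \<bullet> b)\<bar>)" by (rule sum_abs)
  also have "\<dots> \<le> (\<Sum>b\<in>Basis. infnorm u * \<bar>v \<bullet> b\<bar>)"
    by (intro sum_mono) (simp add: abs_mult mult_right_mono Basis_le_infnorm)
  finally show ?thesis by (simp add: l1norm_def sum_distrib_left)
qed

lemma prob_simplex_nonempty: "(prob_simplex :: (real ^ 'n) set) \<noteq> {}"
proof -
  have "(\<chi> i. 1 / real CARD('n)) \<in> (prob_simplex :: (real ^ 'n) set)"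
    by (simp add: prob_simplex_def)
  thus ?thesis by blast
qed

lemma convex_prob_simplex: "convex (prob_simplex :: (real ^ 'n) set)"
  unfolding convex_def prob_simplex_def
  by (auto simp: sum.distrib sum_distrib_left[symmetric])

lemma l1norm_prob_simplex:
  assumes "x \<in> prob_simplex" shows "l1norm x = 1"
  using assms by (simp add: prob_simplex_def l1norm_vec)

lemma l1norm_prob_simplex_diff:
  fixes x y :: "real ^ 'n"
  assumes "x \<in> prob_simplex" "y \<in> prob_simplex"
  shows "l1norm (x - y) \<le> 2"
proof -
  have "l1norm (x - y) \<le> (\<Sum>i\<in>UNIV. \<bar>x $ i\<bar> + \<bar>y $ i\<bar>)"
    unfolding l1norm_vec by (intro sum_mono) (simp add: abs_triangle_ineq4)
  also have "\<dots> = l1norm x + l1norm y" by (simp add: l1norm_vec sum.distrib)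
  finally show ?thesis using assms by (simp add: l1norm_prob_simplex)
qed

lemma compact_prob_simplex: "compact (prob_simplex :: (real ^ 'n) set)"
proof -
  have "prob_simplex = (\<Inter>i. {x :: real ^ 'n. 0 \<le> x $ i}) \<inter> {x. (\<Sum>i\<in>UNIV. x $ i) = 1}"
    by (auto simp: prob_simplex_def)
  moreover have "closed ((\<Inter>i. {x :: real ^ 'n. 0 \<le> x $ i}) \<inter> {x. (\<Sum>i\<in>UNIV. x $ i) = 1})"
    by (intro closed_Int closed_INT ballI closed_Collect_le closed_Collect_eq continuous_intros)
  ultimately have "closed (prob_simplex :: (real ^ 'n) set)" by simp
  moreover have "bounded (prob_simplex :: (real ^ 'n) set)"
    unfolding bounded_iff
  proof (intro exI ballI)
    fix x :: "real ^ 'n" assume "x \<in> prob_simplex"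
    thus "norm x \<le> 1" using norm_le_l1_cart[of x] l1norm_prob_simplex[of x] by (simp add: l1norm_vec)
  qed
  ultimately show ?thesis by (simp add: compact_eq_bounded_closed)
qed

text \<open>The inner product is a convex combination of the coordinates of \<open>z\<close>. This
  reduces a supremum over the simplex to a finite maximum, as
  \<open>expectation_Max_subgaussian\<close> needs.\<close>

lemma inner_prob_simplex_le_Max:
  fixes w z :: "real ^ 'n"
  assumes "w \<in> prob_simplex"
  shows "z \<bullet> w \<le> Max (range (\<lambda>j. z $ j))"
proof -
  have "z \<bullet> w = (\<Sum>j\<in>UNIV. z $ j * w $ j)" by (simp add: inner_vec_def)
  also have "\<dots> \<le> (\<Sum>j\<in>UNIV. Max (range (\<lambda>j. z $ j)) * w $ j)"
    using assms by (intro sum_mono mult_right_mono) (auto simp: prob_simplex_def)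
  finally show ?thesis using assms by (simp add: prob_simplex_def sum_distrib_left[symmetric])
qed

section \<open>Averages and the bias of a smooth function\<close>

lemma avg_in_prob_simplex:
  fixes u :: "nat \<Rightarrow> real ^ 'n"
  assumes "0 < N" "\<And>t. t \<in> {1..N} \<Longrightarrow> u t \<in> prob_simplex"
  shows "avg N u \<in> prob_simplex"
proof -
  have "avg N u = (\<Sum>t\<in>{1..N}. (1 / real N) *\<^sub>R u t)"
    by (simp add: avg_def scaleR_sum_right)
  also have "\<dots> \<in> prob_simplex"
    using assms by (intro convex_sum convex_prob_simplex) auto
  finally show ?thesis .
qed

lemma avg_cong: "(\<And>t. t \<in> {1..N} \<Longrightarrow> u t = v t) \<Longrightarrow> avg N u = avg N v"
  by (simp add: avg_def)

lemma fst_avg: "fst (avg N u) = avg N (\<lambda>t. fst (u t))"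
  by (simp add: avg_def fst_sum)

lemma snd_avg: "snd (avg N u) = avg N (\<lambda>t. snd (u t))"
  by (simp add: avg_def snd_sum)

text \<open>The effect of resampling one vertex; it gives both the bounded differences and the step
  length \<open>2 / N\<close>.\<close>

lemma avg_upd_diff:
  assumes "i \<in> {1..N}"
  shows "avg N (u(i := a)) - avg N (u(i := b)) = (1 / real N) *\<^sub>R (a - b)"
proof -
  have "(\<Sum>t\<in>{1..N}. (u(i := c)) t) = c + (\<Sum>t\<in>{1..N} - {i}. u t)" for c
    using assms by (subst sum.remove[where x = i]) auto
  thus ?thesis by (simp add: avg_def algebra_simps)
qed

text \<open>The random points are replaced by their means one at a time. The linear term of each
  replacement has expectation zero, and the quadratic term is at most
  \<open>L / 2 * (2 / N)\<^sup>2\<close>; the \<open>N\<close> replacements sum to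
  \<open>2 * L / N\<close>.\<close>

lemma expectation_smooth_avg_le:
  fixes \<phi> :: "real ^ 'n \<Rightarrow> real" and \<xi> :: "'c \<Rightarrow> real ^ 'n"
  assumes smooth: "\<And>x x'. x \<in> prob_simplex \<Longrightarrow> x' \<in> prob_simplex \<Longrightarrow>
      \<phi> x' \<le> \<phi> x + g x \<bullet> (x' - x) + L / 2 * (l1norm (x' - x))\<^sup>2"
    and L: "0 \<le> L" and N: "0 < N"
    and fin: "\<And>t. t \<in> {1..N} \<Longrightarrow> finite (set_pmf (q t))"
    and \<xi>: "\<And>t a. t \<in> {1..N} \<Longrightarrow> a \<in> set_pmf (q t) \<Longrightarrow> \<xi> a \<in> prob_simplex"
    and m: "\<And>t. t \<in> {1..N} \<Longrightarrow> m t \<in> prob_simplex"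
    and mean: "\<And>t. t \<in> {1..N} \<Longrightarrow> measure_pmf.expectation (q t) \<xi> = m t"
  shows "measure_pmf.expectation (Pi_pmf {1..N} d q) (\<lambda>r. \<phi> (avg N (\<lambda>t. \<xi> (r t))))
    \<le> \<phi> (avg N m) + 2 * L / real N"
proof -
  \<comment> \<open>\<open>A\<close> holds the indices that are still random. The points
    \<open>u\<close> at the other indices stay arbitrary, so that the induction hypothesis applies
    with a sampled point frozen at \<open>i\<close>.\<close>
  have "measure_pmf.expectation (Pi_pmf A d q) (\<lambda>r. \<phi> (avg N (\<lambda>t. if t \<in> A then \<xi> (r t) else u t)))
    \<le> \<phi> (avg N (\<lambda>t. if t \<in> A then m t else u t)) + real (card A) * (2 * L / (real N)\<^sup>2)"
    if "finite A" "A \<subseteq> {1..N}" "\<And>t. t \<in> {1..N} \<Longrightarrow> u t \<in> prob_simplex" for A u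
    using that
  proof (induction A arbitrary: u rule: finite_induct)
    case empty
    then show ?case by simp
  next
    case (insert i A)
    hence i: "i \<in> {1..N}" by auto
    \<comment> \<open>In \<open>v\<close> the indices of \<open>A\<close> already carry their means;
      \<open>x\<close> carries the mean at \<open>i\<close> too and is the point of
      expansion.\<close>
    define v where "v t = (if t \<in> A then m t else u t)" for t
    define x where "x = avg N (v(i := m i))"
    have fini: "finite (set_pmf (q i))" using fin[OF i] .
    have int: "integrable (measure_pmf (q i)) k" for k :: "'c \<Rightarrow> 'd::{banach, second_countable_topology}"
      by (rule integrable_measure_pmf_finite[OF fini])
    have v: "v t \<in> prob_simplex" if "t \<in> {1..N}" for t
      using that insert.prems m by (auto simp: v_def)
    have vupd: "avg N (v(i := a)) \<in> prob_simplex" if "a \<in> prob_simplex" for a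
      using that v by (intro avg_in_prob_simplex N) auto
    have step: "\<phi> (avg N (v(i := \<xi> a))) \<le> \<phi> x + g x \<bullet> ((1 / real N) *\<^sub>R (\<xi> a - m i)) + 2 * L / (real N)\<^sup>2"
      if a: "a \<in> set_pmf (q i)" for a
    proof -
      have d: "avg N (v(i := \<xi> a)) - x = (1 / real N) *\<^sub>R (\<xi> a - m i)"
        unfolding x_def by (rule avg_upd_diff[OF i])
      \<comment> \<open>The factor 2 is the l1 diameter bound for the simplex.\<close>
      have "l1norm ((1 / real N) *\<^sub>R (\<xi> a - m i)) \<le> 1 / real N * 2"
        unfolding l1norm_scaleR using l1norm_prob_simplex_diff[OF \<xi>[OF i a] m[OF i]] N
        by (simp add: divide_right_mono)
      hence "(l1norm ((1 / real N) *\<^sub>R (\<xi> a - m i)))\<^sup>2 \<le> (2 / real N)\<^sup>2"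
        by (intro power_mono) (auto simp: l1norm_nonneg)
      hence "L / 2 * (l1norm ((1 / real N) *\<^sub>R (\<xi> a - m i)))\<^sup>2 \<le> L / 2 * (2 / real N)\<^sup>2"
        using L by (intro mult_left_mono) auto
      also have "\<dots> = 2 * L / (real N)\<^sup>2" by (simp add: power_divide)
      finally show ?thesis
        using smooth[OF vupd[OF m[OF i]] vupd[OF \<xi>[OF i a]]] d unfolding x_def by simp
    qed
    have "measure_pmf.expectation (q i) (\<lambda>a. g x \<bullet> ((1 / real N) *\<^sub>R (\<xi> a - m i))) = 0"
      using mean[OF i] by (simp add: int inner_diff_right)
    hence avgstep: "measure_pmf.expectation (q i) (\<lambda>a. \<phi> x + g x \<bullet> ((1 / real N) *\<^sub>R (\<xi> a - m i)) + 2 * L / (real N)\<^sup>2)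
      = \<phi> x + 2 * L / (real N)\<^sup>2"
      by (simp add: int)
    have "measure_pmf.expectation (Pi_pmf (insert i A) d q)
        (\<lambda>r. \<phi> (avg N (\<lambda>t. if t \<in> insert i A then \<xi> (r t) else u t)))
      = measure_pmf.expectation (q i) (\<lambda>a. measure_pmf.expectation (Pi_pmf A d q)
          (\<lambda>r. \<phi> (avg N (\<lambda>t. if t \<in> A then \<xi> (r t) else (u(i := \<xi> a)) t))))"
      (is "_ = measure_pmf.expectation _ ?inner")
      using insert.hyps insert.prems fin
      by (subst expectation_Pi_pmf_insert)
         (auto intro!: Bochner_Integration.integral_cong arg_cong[where f = \<phi>] avg_cong)
    also have "\<dots> \<le> measure_pmf.expectation (q i)
        (\<lambda>a. \<phi> (avg N (v(i := \<xi> a))) + real (card A) * (2 * L / (real N)\<^sup>2))"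
    proof (rule expectation_mono_finite_pmf[OF fini])
      fix a assume a: "a \<in> set_pmf (q i)"
      have "?inner a \<le> \<phi> (avg N (\<lambda>t. if t \<in> A then m t else (u(i := \<xi> a)) t)) + real (card A) * (2 * L / (real N)\<^sup>2)"
        using insert.prems \<xi>[OF i a] by (intro insert.IH) auto
      also have "(\<lambda>t. if t \<in> A then m t else (u(i := \<xi> a)) t) = v(i := \<xi> a)"
        using insert.hyps by (auto simp: v_def)
      finally show "?inner a \<le> \<phi> (avg N (v(i := \<xi> a))) + real (card A) * (2 * L / (real N)\<^sup>2)" .
    qed
    also have "\<dots> = measure_pmf.expectation (q i) (\<lambda>a. \<phi> (avg N (v(i := \<xi> a)))) + real (card A) * (2 * L / (real N)\<^sup>2)"
      by (simp add: int)
    also have "measure_pmf.expectation (q i) (\<lambda>a. \<phi> (avg N (v(i := \<xi> a)))) \<le> \<phi> x + 2 * L / (real N)\<^sup>2"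
      unfolding avgstep[symmetric] by (rule expectation_mono_finite_pmf[OF fini]) (rule step)
    also have "v(i := m i) = (\<lambda>t. if t \<in> insert i A then m t else u t)"
      by (auto simp: v_def)
    hence "x = avg N (\<lambda>t. if t \<in> insert i A then m t else u t)" by (simp add: x_def)
    finally show ?case using insert.hyps by (simp add: algebra_simps add_divide_distrib)
  qed
  from this[of "{1..N}" m] m
  have "measure_pmf.expectation (Pi_pmf {1..N} d q) (\<lambda>r. \<phi> (avg N (\<lambda>t. if t \<in> {1..N} then \<xi> (r t) else m t)))
    \<le> \<phi> (avg N m) + real N * (2 * L / (real N)\<^sup>2)" by simp
  moreover have "avg N (\<lambda>t. if t \<in> {1..N} then \<xi> (r t) else m t) = avg N (\<lambda>t. \<xi> (r t))" for r
    by (intro avg_cong) simp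
  moreover have "real N * (2 * L / (real N)\<^sup>2) = 2 * L / real N"
    using N by (simp add: power2_eq_square)
  ultimately show ?thesis by simp
qed

text \<open>Divide by \<open>s\<close> and let it tend to zero. This extracts first-order conditions
  from quadratic bounds along a segment.\<close>

lemma le_of_le_add_small:
  fixes a b c :: real
  assumes "\<And>s. 0 < s \<Longrightarrow> s \<le> 1 \<Longrightarrow> s * a \<le> s * b + s\<^sup>2 * c"
  shows "a \<le> b"
proof (rule field_le_epsilon)
  fix e :: real assume e: "0 < e"
  define s where "s = min 1 (e / (\<bar>c\<bar> + 1))"
  have s: "0 < s" "s \<le> 1" "s \<le> e / (\<bar>c\<bar> + 1)" using e by (auto simp: s_def)
  have "s * a \<le> s * (b + s * c)" using assms[OF s(1,2)] by (simp add: power2_eq_square algebra_simps)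
  hence "a \<le> b + s * c" using s(1) by (simp only: mult_le_cancel_left_pos)
  also have "s * c \<le> s * (\<bar>c\<bar> + 1)" using s by (intro mult_left_mono) auto
  also have "\<dots> \<le> e" using s(3) by (simp add: pos_le_divide_eq)
  finally show "a \<le> b + e" by simp
qed

section \<open>Random vertices of the simplex\<close>

lemma vertex_pmf_props:
  fixes x :: "real ^ 'n"
  assumes "x \<in> prob_simplex"
  shows finite_set_vertex_pmf: "finite (set_pmf (vertex_pmf x))"
    and set_vertex_pmf: "set_pmf (vertex_pmf x) \<subseteq> prob_simplex"
    and expectation_vertex_pmf: "measure_pmf.expectation (vertex_pmf x) (\<lambda>u. u) = x"
proof -
  \<comment> \<open>\<open>embed_pmf\<close> has the intended weights only once their total mass is
    known to be one.\<close>
  have nn: "(\<integral>\<^sup>+ i. ennreal (x $ i) \<partial>count_space UNIV) = 1"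
    using assms by (simp add: prob_simplex_def nn_integral_count_space_finite sum_ennreal)
  have pmf: "pmf (embed_pmf (\<lambda>i. x $ i)) i = x $ i" for i
    using assms nn by (intro pmf_embed_pmf) (auto simp: prob_simplex_def)
  show "finite (set_pmf (vertex_pmf x))" by (simp add: vertex_pmf_def)
  show "set_pmf (vertex_pmf x) \<subseteq> prob_simplex"
    by (auto simp: vertex_pmf_def prob_simplex_def axis_def)
  show "measure_pmf.expectation (vertex_pmf x) (\<lambda>u. u) = x"
    unfolding vertex_pmf_def
    by (simp add: integral_measure_pmf[where A = UNIV] pmf vec_eq_iff axis_def if_distrib cong: if_cong)
qed

lemma vertex_pair_pmf_props:
  fixes p :: "(real ^ 'n) \<times> (real ^ 'm)"
  assumes "p \<in> prob_simplex \<times> prob_simplex"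
  shows finite_set_vertex_pair_pmf: "finite (set_pmf (vertex_pair_pmf p))"
    and set_vertex_pair_pmf: "set_pmf (vertex_pair_pmf p) \<subseteq> prob_simplex \<times> prob_simplex"
    and expectation_vertex_pair_pmf_fst: "measure_pmf.expectation (vertex_pair_pmf p) fst = fst p"
    and expectation_vertex_pair_pmf_snd: "measure_pmf.expectation (vertex_pair_pmf p) snd = snd p"
proof -
  have p: "fst p \<in> prob_simplex" "snd p \<in> prob_simplex" using assms by auto
  note 1 = vertex_pmf_props[OF p(1)] and 2 = vertex_pmf_props[OF p(2)]
  show "finite (set_pmf (vertex_pair_pmf p))" using 1 2 by (simp add: vertex_pair_pmf_def)
  show "set_pmf (vertex_pair_pmf p) \<subseteq> prob_simplex \<times> prob_simplex"
    using 1 2 by (auto simp: vertex_pair_pmf_def)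
  show "measure_pmf.expectation (vertex_pair_pmf p) fst = fst p"
    using 1 expectation_pair_pmf_fst[of "vertex_pmf (fst p)" "vertex_pmf (snd p)" "\<lambda>u. u"]
    by (simp add: vertex_pair_pmf_def)
  show "measure_pmf.expectation (vertex_pair_pmf p) snd = snd p"
    using 2 expectation_pair_pmf_snd[of "vertex_pmf (fst p)" "vertex_pmf (snd p)" "\<lambda>u. u"]
    by (simp add: vertex_pair_pmf_def)
qed

section \<open>The maximum of a concave objective at a random average\<close>

text \<open>One half of the gap, stated so that it serves both players: \<open>H\<close> will be the
  objective, or its negative with the arguments exchanged. \<open>Hx\<close> and \<open>Hy\<close>
  act as partial gradients. The upper bound \<open>smooth_x\<close> controls the bias of the random
  average, and the lower bound \<open>smooth_y\<close> gives the optimality condition in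
  \<open>w\<close>.\<close>

locale l1_smooth_concave =
  fixes H :: "real ^ 'n \<Rightarrow> real ^ 'm \<Rightarrow> real"
    and Hx :: "real ^ 'n \<Rightarrow> real ^ 'm \<Rightarrow> real ^ 'n"
    and Hy :: "real ^ 'n \<Rightarrow> real ^ 'm \<Rightarrow> real ^ 'm"
    and L C :: real
  assumes L_nonneg: "0 \<le> L"
    and smooth_x: "\<And>x x' w. x \<in> prob_simplex \<Longrightarrow> x' \<in> prob_simplex \<Longrightarrow> w \<in> prob_simplex \<Longrightarrow>
      H x' w \<le> H x w + Hx x w \<bullet> (x' - x) + L / 2 * (l1norm (x' - x))\<^sup>2"
    and smooth_y: "\<And>x w w'. x \<in> prob_simplex \<Longrightarrow> w \<in> prob_simplex \<Longrightarrow> w' \<in> prob_simplex \<Longrightarrow>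
      H x w + Hy x w \<bullet> (w' - w) - L / 2 * (l1norm (w' - w))\<^sup>2 \<le> H x w'"
    and concave_y: "\<And>x w w'. x \<in> prob_simplex \<Longrightarrow> w \<in> prob_simplex \<Longrightarrow> w' \<in> prob_simplex \<Longrightarrow>
      H x w' \<le> H x w + Hy x w \<bullet> (w' - w)"
    and lipschitz_grad: "\<And>x x' w. x \<in> prob_simplex \<Longrightarrow> x' \<in> prob_simplex \<Longrightarrow> w \<in> prob_simplex \<Longrightarrow>
      infnorm (Hy x w - Hy x' w) \<le> L * l1norm (x - x')"
    and bounded_grad: "\<And>x w. x \<in> prob_simplex \<Longrightarrow> w \<in> prob_simplex \<Longrightarrow> infnorm (Hy x w) \<le> C"
begin

text \<open>The supergradient inequality, used from both endpoints, bounds the change in each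
  direction.\<close>

lemma lipschitz_y:
  assumes "x \<in> prob_simplex" "w \<in> prob_simplex" "w' \<in> prob_simplex"
  shows "\<bar>H x w' - H x w\<bar> \<le> C * l1norm (w' - w)"
proof -
  have "H x v' - H x v \<le> C * l1norm (v' - v)" if "v \<in> prob_simplex" "v' \<in> prob_simplex" for v v'
  proof -
    have "H x v' - H x v \<le> \<bar>Hy x v \<bullet> (v' - v)\<bar>" using concave_y[OF assms(1) that] by simp
    also have "\<dots> \<le> infnorm (Hy x v) * l1norm (v' - v)" by (rule inner_le_infnorm_l1norm)
    also have "\<dots> \<le> C * l1norm (v' - v)"
      by (intro mult_right_mono bounded_grad assms that l1norm_nonneg)
    finally show ?thesis .
  qed
  from this[of w w'] this[of w' w] assms show ?thesis by (simp add: l1norm_minus_commute abs_le_iff)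
qed

lemma C_nonneg: "0 \<le> C"
proof -
  obtain x :: "real ^ 'n" where x: "x \<in> prob_simplex" using prob_simplex_nonempty by blast
  obtain w :: "real ^ 'm" where w: "w \<in> prob_simplex" using prob_simplex_nonempty by blast
  show ?thesis using bounded_grad[OF x w] infnorm_pos_le[of "Hy x w"] by linarith
qed

lemma continuous_on_y:
  assumes "x \<in> prob_simplex"
  shows "continuous_on prob_simplex (H x)"
proof (rule lipschitz_on_continuous_on)
  show "(C * real DIM(real ^ 'm))-lipschitz_on prob_simplex (H x)"
  proof (rule lipschitz_onI)
    fix w w' :: "real ^ 'm" assume w: "w \<in> prob_simplex" "w' \<in> prob_simplex"
    have "dist (H x w) (H x w') \<le> C * l1norm (w - w')"
      using lipschitz_y[OF assms w(2,1)] by (simp add: dist_real_def)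
    also have "\<dots> \<le> C * (real DIM(real ^ 'm) * norm (w - w'))"
      by (intro mult_left_mono l1norm_le_norm C_nonneg)
    finally show "dist (H x w) (H x w') \<le> C * real DIM(real ^ 'm) * dist w w'"
      by (simp add: dist_norm mult.assoc)
  qed (simp add: C_nonneg)
qed

text \<open>Suprema of reals are informative only for sets bounded above; compactness provides
  this.\<close>

lemma bdd_above_y:
  assumes "x \<in> prob_simplex"
  shows "bdd_above (H x ` prob_simplex)"
  using compact_continuous_image[OF continuous_on_y[OF assms] compact_prob_simplex]
  by (intro bounded_imp_bdd_above compact_imp_bounded)

text \<open>The reference point \<open>w0\<close> depends only on the law of the sample. Hence
  \<open>H (X r) w0\<close> can be compared with its value at the mean, and the gradient fluctuation
  \<open>\<zeta>\<close> at \<open>w0\<close> is centred; the last two summands are the costs of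
  these two effects.\<close>

lemma expectation_Sup_avg_le:
  fixes \<xi> :: "'c \<Rightarrow> real ^ 'n"
  assumes N: "0 < N"
    and fin: "\<And>t. t \<in> {1..N} \<Longrightarrow> finite (set_pmf (q t))"
    and \<xi>: "\<And>t a. t \<in> {1..N} \<Longrightarrow> a \<in> set_pmf (q t) \<Longrightarrow> \<xi> a \<in> prob_simplex"
    and m: "\<And>t. t \<in> {1..N} \<Longrightarrow> m t \<in> prob_simplex"
    and mean: "\<And>t. t \<in> {1..N} \<Longrightarrow> measure_pmf.expectation (q t) \<xi> = m t"
  shows "measure_pmf.expectation (Pi_pmf {1..N} d q)
      (\<lambda>r. SUP w\<in>prob_simplex. H (avg N (\<lambda>t. \<xi> (r t))) w)
    \<le> (SUP w\<in>prob_simplex. H (avg N m) w) + 2 * L / real N + L * sqrt (2 * ln (real CARD('m)) / real N)"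
proof -
  define M where "M = Pi_pmf {1..N} d q"
  define E :: "((nat \<Rightarrow> 'c) \<Rightarrow> real) \<Rightarrow> real" where "E = measure_pmf.expectation M"
  define X where "X r = avg N (\<lambda>t. \<xi> (r t))" for r
  define \<Phi> where "\<Phi> w = E (\<lambda>r. H (X r) w)" for w
  have finM: "finite (set_pmf M)" unfolding M_def by (intro finite_set_Pi_pmf fin) auto
  have int [simp]: "integrable (measure_pmf M) k" for k :: "(nat \<Rightarrow> 'c) \<Rightarrow> real"
    by (rule integrable_measure_pmf_finite[OF finM])
  have X': "X r \<in> prob_simplex" if "\<And>t. t \<in> {1..N} \<Longrightarrow> r t \<in> set_pmf (q t)" for r
    unfolding X_def using that by (intro avg_in_prob_simplex N \<xi>)
  have X: "X r \<in> prob_simplex" if "r \<in> set_pmf M" for r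
    using that by (intro X') (auto simp: M_def set_Pi_pmf PiE_dflt_def)
  have E_mono: "E g \<le> E h" if "\<And>r. r \<in> set_pmf M \<Longrightarrow> g r \<le> h r" for g h
    unfolding E_def using that by (intro expectation_mono_finite_pmf finM)
  have \<Phi>_sum: "\<Phi> = (\<lambda>w. \<Sum>r\<in>set_pmf M. pmf M r * H (X r) w)"
    unfolding \<Phi>_def E_def by (simp add: integral_measure_pmf[OF finM])
  \<comment> \<open>Finite support makes \<open>\<Phi>\<close> a finite combination of continuous
    functions, so it attains its maximum on the compact simplex.\<close>
  have "continuous_on prob_simplex \<Phi>"
    unfolding \<Phi>_sum by (intro continuous_intros continuous_on_y X)
  then obtain w0 where w0: "w0 \<in> prob_simplex" and max: "\<And>w. w \<in> prob_simplex \<Longrightarrow> \<Phi> w \<le> \<Phi> w0"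
    using continuous_attains_sup[OF compact_prob_simplex prob_simplex_nonempty] by blast
  \<comment> \<open>The mean gradient acts as a gradient of \<open>\<Phi>\<close> at
    \<open>w0\<close>; the averaged \<open>smooth_y\<close> replaces a proof of
    differentiability.\<close>
  define \<mu> :: "real ^ 'm" where "\<mu> = (\<chi> j. E (\<lambda>r. Hy (X r) w0 $ j))"
  define \<zeta> where "\<zeta> r = Hy (X r) w0 - \<mu>" for r
  have E_inner: "E (\<lambda>r. Hy (X r) w0 \<bullet> v) = \<mu> \<bullet> v" for v
    by (simp add: E_def inner_vec_def \<mu>_def)
  have opt: "\<mu> \<bullet> (w - w0) \<le> 0" if w: "w \<in> prob_simplex" for w
  proof (rule le_of_le_add_small)
    fix s :: real assume s: "0 < s" "s \<le> 1"
    \<comment> \<open>A short move from the maximizer towards \<open>w\<close> cannot increase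
      \<open>\<Phi>\<close>, so the linear gain is at most the quadratic error.\<close>
    define ws where "ws = w0 + s *\<^sub>R (w - w0)"
    have "ws = (1 - s) *\<^sub>R w0 + s *\<^sub>R w" by (simp add: ws_def algebra_simps)
    hence ws: "ws \<in> prob_simplex"
      using convexD_alt[OF convex_prob_simplex w0 w, of s] s by simp
    have d: "ws - w0 = s *\<^sub>R (w - w0)" by (simp add: ws_def)
    have "E (\<lambda>r. H (X r) w0 + Hy (X r) w0 \<bullet> (ws - w0) - L / 2 * (l1norm (ws - w0))\<^sup>2) \<le> \<Phi> ws"
      unfolding \<Phi>_def by (intro E_mono smooth_y X w0 ws)
    hence "\<Phi> w0 + \<mu> \<bullet> (ws - w0) - L / 2 * (l1norm (ws - w0))\<^sup>2 \<le> \<Phi> ws"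
      using E_inner[of "ws - w0"] by (simp add: E_def \<Phi>_def)
    hence "\<mu> \<bullet> (ws - w0) \<le> L / 2 * (l1norm (ws - w0))\<^sup>2" using max[OF ws] by simp
    thus "s * (\<mu> \<bullet> (w - w0)) \<le> s * 0 + s\<^sup>2 * (L / 2 * (l1norm (w - w0))\<^sup>2)"
      unfolding d l1norm_scaleR using s by (simp add: power_mult_distrib algebra_simps)
  qed
  have sup: "(SUP w\<in>prob_simplex. H (X r) w) \<le> H (X r) w0 + Max (range (\<lambda>j. \<zeta> r $ j)) - \<zeta> r \<bullet> w0"
    if r: "r \<in> set_pmf M" for r
  proof (rule cSUP_least[OF prob_simplex_nonempty])
    fix w :: "real ^ 'm" assume w: "w \<in> prob_simplex"
    have "H (X r) w \<le> H (X r) w0 + Hy (X r) w0 \<bullet> (w - w0)" by (rule concave_y[OF X[OF r] w0 w])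
    \<comment> \<open>The \<open>\<mu>\<close> term is nonpositive by \<open>opt\<close>. The term
      \<open>\<zeta> r \<bullet> w0\<close> is kept exactly because its expectation
      vanishes.\<close>
    also have "\<dots> = H (X r) w0 + \<mu> \<bullet> (w - w0) + \<zeta> r \<bullet> w - \<zeta> r \<bullet> w0"
      by (simp add: \<zeta>_def algebra_simps)
    also have "\<dots> \<le> H (X r) w0 + Max (range (\<lambda>j. \<zeta> r $ j)) - \<zeta> r \<bullet> w0"
      using opt[OF w] inner_prob_simplex_le_Max[OF w, of "\<zeta> r"] by simp
    finally show "H (X r) w \<le> H (X r) w0 + Max (range (\<lambda>j. \<zeta> r $ j)) - \<zeta> r \<bullet> w0" .
  qed
  have mgf: "E (\<lambda>r. exp (l * \<zeta> r $ j)) \<le> exp (l\<^sup>2 * (L\<^sup>2 / real N) / 2)" if l: "0 < l" for l j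
  proof -
    have "E (\<lambda>r. exp (l * (Hy (X r) w0 $ j - E (\<lambda>r. Hy (X r) w0 $ j))))
      \<le> exp (l\<^sup>2 * (\<Sum>i\<in>{1..N}. (2 * L / real N)\<^sup>2) / 8)"
      unfolding E_def M_def
    proof (rule mcdiarmid_mgf)
      fix r i a b assume r: "\<And>j. j \<in> {1..N} \<Longrightarrow> r j \<in> set_pmf (q j)" and i: "i \<in> {1..N}"
        and ab: "a \<in> set_pmf (q i)" "b \<in> set_pmf (q i)"
      have Xab: "X (r(i := a)) \<in> prob_simplex" "X (r(i := b)) \<in> prob_simplex"
        using r ab by (auto intro!: X')
      have upd: "(\<lambda>t. \<xi> ((r(i := c)) t)) = (\<lambda>t. \<xi> (r t))(i := \<xi> c)" for c by auto
      have dX: "X (r(i := a)) - X (r(i := b)) = (1 / real N) *\<^sub>R (\<xi> a - \<xi> b)"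
        unfolding X_def upd by (rule avg_upd_diff[OF i])
      have "Hy (X (r(i := a))) w0 $ j - Hy (X (r(i := b))) w0 $ j
        \<le> infnorm (Hy (X (r(i := a))) w0 - Hy (X (r(i := b))) w0)"
        using component_le_infnorm_cart[of "Hy (X (r(i := a))) w0 - Hy (X (r(i := b))) w0" j] by simp
      also have "\<dots> \<le> L * l1norm (X (r(i := a)) - X (r(i := b)))"
        by (rule lipschitz_grad[OF Xab w0])
      also have "\<dots> \<le> L * (1 / real N * 2)"
        unfolding dX l1norm_scaleR using l1norm_prob_simplex_diff[OF \<xi>[OF i ab(1)] \<xi>[OF i ab(2)]]
        by (intro mult_left_mono L_nonneg mult_mono) (auto simp: l1norm_nonneg)
      also have "\<dots> = 2 * L / real N" by simp
      finally show "Hy (X (r(i := a))) w0 $ j - Hy (X (r(i := b))) w0 $ j \<le> 2 * L / real N" .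
    qed (use fin l in auto)
    \<comment> \<open>The \<open>N\<close> squared differences sum to
      \<open>4 * L\<^sup>2 / N\<close>, which gives the variance proxy
      \<open>L\<^sup>2 / N\<close>.\<close>
    also have "l\<^sup>2 * (\<Sum>i\<in>{1..N}. (2 * L / real N)\<^sup>2) / 8 = l\<^sup>2 * (L\<^sup>2 / real N) / 2"
      using N by (simp add: power2_eq_square field_simps)
    finally show ?thesis by (simp add: \<zeta>_def \<mu>_def)
  qed
  have E_Max: "E (\<lambda>r. Max (range (\<lambda>j. \<zeta> r $ j))) \<le> sqrt (2 * (L\<^sup>2 / real N) * ln (real CARD('m)))"
    unfolding E_def by (rule expectation_Max_subgaussian[OF finM]) (use mgf in \<open>auto simp: E_def\<close>)
  have E_center: "E (\<lambda>r. \<zeta> r \<bullet> w0) = 0"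
    using E_inner[of w0] by (simp add: \<zeta>_def inner_diff_left E_def)
  have E_ref: "\<Phi> w0 \<le> H (avg N m) w0 + 2 * L / real N"
    unfolding \<Phi>_def E_def M_def X_def
    by (rule expectation_smooth_avg_le[where \<phi> = "\<lambda>x. H x w0" and g = "\<lambda>x. Hx x w0" and q = q])
       (use N fin \<xi> m mean w0 L_nonneg smooth_x in auto)
  have mbar: "avg N m \<in> prob_simplex" by (intro avg_in_prob_simplex N m)
  have "E (\<lambda>r. SUP w\<in>prob_simplex. H (X r) w)
    \<le> E (\<lambda>r. H (X r) w0 + Max (range (\<lambda>j. \<zeta> r $ j)) - \<zeta> r \<bullet> w0)"
    by (intro E_mono sup)
  also have "\<dots> = \<Phi> w0 + E (\<lambda>r. Max (range (\<lambda>j. \<zeta> r $ j)))"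
    using E_center by (simp add: E_def \<Phi>_def)
  also have "\<dots> \<le> H (avg N m) w0 + 2 * L / real N + sqrt (2 * (L\<^sup>2 / real N) * ln (real CARD('m)))"
    using E_ref E_Max by linarith
  also have "2 * (L\<^sup>2 / real N) * ln (real CARD('m)) = L\<^sup>2 * (2 * ln (real CARD('m)) / real N)" by simp
  also have "sqrt \<dots> = L * sqrt (2 * ln (real CARD('m)) / real N)"
    using L_nonneg by (subst real_sqrt_mult) simp
  also have "H (avg N m) w0 \<le> (SUP w\<in>prob_simplex. H (avg N m) w)"
    by (intro cSUP_upper w0 bdd_above_y mbar)
  finally show ?thesis by (simp add: E_def M_def X_def)
qed

end

section \<open>Gradients and smoothness\<close>

text \<open>The derivative is a linear functional and is represented by the vector of its values on
  the basis; uniqueness of derivatives then resolves the description in \<open>grad\<close>.\<close>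

lemma GDERIV_grad:
  fixes F :: "'a::euclidean_space \<Rightarrow> real"
  assumes "F differentiable (at u)"
  shows "GDERIV F u :> grad F u"
proof -
  from assms obtain F' where F': "(F has_derivative F') (at u)"
    by (auto simp: differentiable_def)
  interpret F': linear F' using has_derivative_linear[OF F'] .
  have "F' = (\<lambda>h. h \<bullet> (\<Sum>b\<in>Basis. F' b *\<^sub>R b))"
  proof
    fix h
    have "F' h = F' (\<Sum>b\<in>Basis. (h \<bullet> b) *\<^sub>R b)" by (simp add: euclidean_representation)
    also have "\<dots> = (\<Sum>b\<in>Basis. (h \<bullet> b) * F' b)" by (simp add: F'.sum F'.scale)
    finally show "F' h = h \<bullet> (\<Sum>b\<in>Basis. F' b *\<^sub>R b)"
      by (simp add: inner_sum_right mult.commute)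
  qed
  hence ex: "GDERIV F u :> (\<Sum>b\<in>Basis. F' b *\<^sub>R b)" using F' by (simp add: gderiv_def)
  show ?thesis unfolding grad_def
  proof (rule theI[where P = "\<lambda>D. GDERIV F u :> D", OF ex])
    fix D assume "GDERIV F u :> D"
    hence "(\<lambda>h. h \<bullet> D) = (\<lambda>h. h \<bullet> (\<Sum>b\<in>Basis. F' b *\<^sub>R b))"
      using ex unfolding gderiv_def by (rule has_derivative_unique)
    hence "h \<bullet> D = h \<bullet> (\<Sum>b\<in>Basis. F' b *\<^sub>R b)" for h by (rule fun_cong)
    thus "D = (\<Sum>b\<in>Basis. F' b *\<^sub>R b)"
      using vector_eq_ldot by blast
  qed
qed

lemma has_real_derivative_line:
  fixes F :: "'a::euclidean_space \<Rightarrow> real"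
  assumes "F differentiable (at (u + s *\<^sub>R d))"
  shows "((\<lambda>s. F (u + s *\<^sub>R d)) has_real_derivative grad F (u + s *\<^sub>R d) \<bullet> d) (at s)"
proof -
  have "((\<lambda>s. u + s *\<^sub>R d) has_derivative (\<lambda>h. h *\<^sub>R d)) (at s)"
    by (auto intro!: derivative_eq_intros)
  from has_derivative_compose[OF this GDERIV_grad[OF assms, unfolded gderiv_def]]
  have "((\<lambda>s. F (u + s *\<^sub>R d)) has_derivative (\<lambda>h. (h *\<^sub>R d) \<bullet> grad F (u + s *\<^sub>R d))) (at s)" .
  moreover have "(\<lambda>h. (h *\<^sub>R d) \<bullet> grad F (u + s *\<^sub>R d)) = (*) (grad F (u + s *\<^sub>R d) \<bullet> d)"
    by (rule ext) (simp add: inner_commute)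
  ultimately show ?thesis by (simp only: has_field_derivative_def)
qed

text \<open>The descent lemma in l1 geometry. Along the segment the directional derivative drifts
  from its initial value at a rate controlled by \<open>L\<close>.\<close>

lemma l1_smooth_quadratic_bound:
  fixes F :: "'a::euclidean_space \<Rightarrow> real"
  assumes smooth: "l1_smooth L F A" and A: "convex A" and u: "u \<in> A" "u' \<in> A"
  shows "\<bar>F u' - F u - grad F u \<bullet> (u' - u)\<bar> \<le> L / 2 * (l1norm (u' - u))\<^sup>2"
proof -
  define d where "d = u' - u"
  have mem: "u + s *\<^sub>R d \<in> A" if "0 \<le> s" "s \<le> 1" for s
    using convexD_alt[OF A u that] by (simp add: d_def algebra_simps)
  have bound: "\<bar>grad F (u + s *\<^sub>R d) \<bullet> d - grad F u \<bullet> d\<bar> \<le> L * s * (l1norm d)\<^sup>2" if s: "0 \<le> s" "s \<le> 1" for s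
  proof -
    have "\<bar>(grad F (u + s *\<^sub>R d) - grad F u) \<bullet> d\<bar> \<le> infnorm (grad F (u + s *\<^sub>R d) - grad F u) * l1norm d"
      by (rule inner_le_infnorm_l1norm)
    also have "\<dots> \<le> L * l1norm (u + s *\<^sub>R d - u) * l1norm d"
    proof (rule mult_right_mono)
      show "infnorm (grad F (u + s *\<^sub>R d) - grad F u) \<le> L * l1norm (u + s *\<^sub>R d - u)"
        using smooth mem[OF s] u unfolding l1_smooth_def by blast
    qed (rule l1norm_nonneg)
    finally show ?thesis using s by (simp add: inner_diff_left l1norm_scaleR power2_eq_square mult.assoc)
  qed
  have aux: "\<sigma> * (F u' - F u - grad F u \<bullet> d) \<le> L / 2 * (l1norm d)\<^sup>2" if \<sigma>: "\<bar>\<sigma>\<bar> = 1" for \<sigma>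
  proof -
    \<comment> \<open>Subtracting the linear part and the allowed quadratic error leaves a
      nonincreasing function, and its endpoint values give the claim. The sign
      \<open>\<sigma>\<close> yields both one-sided bounds.\<close>
    define \<psi> where "\<psi> s = \<sigma> * (F (u + s *\<^sub>R d) - s * (grad F u \<bullet> d)) - L / 2 * s\<^sup>2 * (l1norm d)\<^sup>2" for s
    have "\<psi> 1 \<le> \<psi> 0"
    proof (rule DERIV_nonpos_imp_nonincreasing[where f = \<psi>])
      fix s :: real assume s: "0 \<le> s" "s \<le> 1"
      have diff: "F differentiable (at (u + s *\<^sub>R d))"
        using smooth mem[OF s] by (auto simp: l1_smooth_def)
      have "(\<psi> has_real_derivative \<sigma> * (grad F (u + s *\<^sub>R d) \<bullet> d - grad F u \<bullet> d) - L * s * (l1norm d)\<^sup>2) (at s)"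
        unfolding \<psi>_def[abs_def]
        by (rule derivative_eq_intros has_real_derivative_line[OF diff] refl)+ (simp add: algebra_simps)
      moreover have "\<sigma> * (grad F (u + s *\<^sub>R d) \<bullet> d - grad F u \<bullet> d) - L * s * (l1norm d)\<^sup>2 \<le> 0"
      proof -
        have "\<sigma> * (grad F (u + s *\<^sub>R d) \<bullet> d - grad F u \<bullet> d)
            \<le> \<bar>\<sigma>\<bar> * \<bar>grad F (u + s *\<^sub>R d) \<bullet> d - grad F u \<bullet> d\<bar>"
          by (metis abs_ge_self abs_mult)
        thus ?thesis using bound[OF s] \<sigma> by simp
      qed
      ultimately show "\<exists>y. (\<psi> has_real_derivative y) (at s) \<and> y \<le> 0" by blast
    qed simp
    moreover have "u + d = u'" by (simp add: d_def)
    ultimately show ?thesis by (simp add: \<psi>_def right_diff_distrib)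
  qed
  from aux[of 1] aux[of "-1"] show ?thesis unfolding d_def by (intro abs_leI) simp_all
qed

section \<open>Components in a product and separable suprema\<close>

lemma infnorm_le:
  fixes u :: "'a::euclidean_space"
  assumes "\<And>b. b \<in> Basis \<Longrightarrow> \<bar>u \<bullet> b\<bar> \<le> c"
  shows "infnorm u \<le> c"
  unfolding infnorm_Max using assms by (intro Max.boundedI) auto

lemma infnorm_fst_le:
  fixes u :: "'a::euclidean_space \<times> 'b::euclidean_space"
  shows "infnorm (fst u) \<le> infnorm u"
proof (rule infnorm_le)
  fix b :: 'a assume "b \<in> Basis"
  hence "\<bar>u \<bullet> (b, 0)\<bar> \<le> infnorm u" by (intro Basis_le_infnorm) (auto simp: Basis_prod_def)
  thus "\<bar>fst u \<bullet> b\<bar> \<le> infnorm u" by (simp add: inner_prod_def)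
qed

lemma infnorm_snd_le:
  fixes u :: "'a::euclidean_space \<times> 'b::euclidean_space"
  shows "infnorm (snd u) \<le> infnorm u"
proof (rule infnorm_le)
  fix b :: 'b assume "b \<in> Basis"
  hence "\<bar>u \<bullet> (0, b)\<bar> \<le> infnorm u" by (intro Basis_le_infnorm) (auto simp: Basis_prod_def)
  thus "\<bar>snd u \<bullet> b\<bar> \<le> infnorm u" by (simp add: inner_prod_def)
qed

text \<open>The two maximizations are uncoupled. For the harder inequality the suprema are taken one
  variable at a time, with the other term moved to the right.\<close>

lemma cSUP_add_prod:
  fixes g :: "'a \<Rightarrow> real" and h :: "'b \<Rightarrow> real"
  assumes "A \<noteq> {}" "B \<noteq> {}" "bdd_above (g ` A)" "bdd_above (h ` B)"
  shows "(SUP (v, w)\<in>A \<times> B. h w + g v) = (SUP w\<in>B. h w) + (SUP v\<in>A. g v)"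
proof (rule antisym)
  have le: "h w + g v \<le> (SUP w\<in>B. h w) + (SUP v\<in>A. g v)" if "v \<in> A" "w \<in> B" for v w
    using that assms by (intro add_mono cSUP_upper)
  hence bdd: "bdd_above ((\<lambda>(v, w). h w + g v) ` (A \<times> B))"
    by (intro bdd_aboveI[where M = "(SUP w\<in>B. h w) + (SUP v\<in>A. g v)"]) auto
  show "(SUP (v, w)\<in>A \<times> B. h w + g v) \<le> (SUP w\<in>B. h w) + (SUP v\<in>A. g v)"
    using le assms by (intro cSUP_least) auto
  have "h w + g v \<le> (SUP (v, w)\<in>A \<times> B. h w + g v)" if "v \<in> A" "w \<in> B" for v w
    using cSUP_upper[OF _ bdd, of "(v, w)"] that by simp
  hence "h w \<le> (SUP (v, w)\<in>A \<times> B. h w + g v) - g v" if "v \<in> A" "w \<in> B" for v w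
    using that by (simp add: le_diff_eq)
  hence "(SUP w\<in>B. h w) \<le> (SUP (v, w)\<in>A \<times> B. h w + g v) - g v" if "v \<in> A" for v
    using that assms by (intro cSUP_least) auto
  hence "g v \<le> (SUP (v, w)\<in>A \<times> B. h w + g v) - (SUP w\<in>B. h w)" if "v \<in> A" for v
    using that by (simp add: le_diff_eq add.commute)
  hence "(SUP v\<in>A. g v) \<le> (SUP (v, w)\<in>A \<times> B. h w + g v) - (SUP w\<in>B. h w)"
    using assms by (intro cSUP_least) auto
  thus "(SUP w\<in>B. h w) + (SUP v\<in>A. g v) \<le> (SUP (v, w)\<in>A \<times> B. h w + g v)" by simp
qed

section \<open>The population objective\<close>

locale l1_saddle_point_problem = prob_space D
  for D :: "'z measure" +
  fixes f :: "(real ^ 'n) \<times> (real ^ 'm) \<Rightarrow> 'z \<Rightarrow> real" and L\<^sub>0 L\<^sub>1 :: real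
  assumes f_measurable: "\<And>p. f p \<in> borel_measurable D"
    and f_integrable: "\<And>p. p \<in> prob_simplex \<times> prob_simplex \<Longrightarrow> integrable D (f p)"
    and f_convex: "\<And>z y. z \<in> space D \<Longrightarrow> y \<in> prob_simplex \<Longrightarrow> convex_on prob_simplex (\<lambda>x. f (x, y) z)"
    and f_concave: "\<And>z x. z \<in> space D \<Longrightarrow> x \<in> prob_simplex \<Longrightarrow> concave_on prob_simplex (\<lambda>y. f (x, y) z)"
    and f_lipschitz: "\<And>z. z \<in> space D
      \<Longrightarrow> l1_lipschitz L\<^sub>0 (\<lambda>p. f p z) (prob_simplex \<times> prob_simplex)"
    and f_smooth: "\<And>z. z \<in> space D
      \<Longrightarrow> l1_smooth L\<^sub>1 (\<lambda>p. f p z) (prob_simplex \<times> prob_simplex)"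
begin

abbreviation "domain \<equiv> (prob_simplex :: (real ^ 'n) set) \<times> (prob_simplex :: (real ^ 'm) set)"

definition F :: "(real ^ 'n) \<times> (real ^ 'm) \<Rightarrow> real" where
  "F = pop_obj D f"

text \<open>The expected sample gradient, integrated coordinate by coordinate. It acts as the
  gradient of \<open>F\<close> through \<open>F_quadratic_bound\<close>, without differentiation
  under the integral sign.\<close>

definition G :: "(real ^ 'n) \<times> (real ^ 'm) \<Rightarrow> (real ^ 'n) \<times> (real ^ 'm)" where
  "G p = (\<Sum>b\<in>Basis. (\<integral>z. grad (\<lambda>q. f q z) p \<bullet> b \<partial>D) *\<^sub>R b)"

lemma L1_nonneg: "0 \<le> L\<^sub>1"
  using not_empty f_smooth by (auto simp: l1_smooth_def)

lemma convex_domain: "convex domain"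
  by (intro convex_Times convex_prob_simplex)

text \<open>The difference quotients leave the simplex, where \<open>f p\<close> is still measurable.\<close>

lemma measurable_grad:
  assumes p: "p \<in> domain"
  shows "(\<lambda>z. grad (\<lambda>q. f q z) p \<bullet> b) \<in> borel_measurable D"
proof (rule borel_measurable_LIMSEQ_real)
  fix z assume z: "z \<in> space D"
  have "(\<lambda>q. f q z) differentiable (at (p + 0 *\<^sub>R b))"
    using f_smooth[OF z] p by (auto simp: l1_smooth_def)
  from has_real_derivative_line[OF this]
  have "((\<lambda>h. (f (p + h *\<^sub>R b) z - f p z) / h) \<longlongrightarrow> grad (\<lambda>q. f q z) p \<bullet> b) (at 0)"
    by (simp add: DERIV_def)
  \<comment> \<open>The derivative is a limit over nonzero increments; a sequence of positive
    increments makes the gradient a sequential limit of measurable functions.\<close>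
  moreover have "filterlim (\<lambda>n. 1 / real (Suc n)) (at 0) sequentially"
    using LIMSEQ_Suc[OF lim_1_over_n] by (intro filterlim_atI) auto
  ultimately show "(\<lambda>n. (f (p + (1 / real (Suc n)) *\<^sub>R b) z - f p z) / (1 / real (Suc n)))
      \<longlonglongrightarrow> grad (\<lambda>q. f q z) p \<bullet> b"
    by (rule filterlim_compose)
qed (intro borel_measurable_divide borel_measurable_diff f_measurable borel_measurable_const)

lemma grad_bound:
  assumes "p \<in> domain" "z \<in> space D"
  shows "infnorm (grad (\<lambda>q. f q z) p) \<le> L\<^sub>0"
  using f_lipschitz[OF assms(2)] assms(1) by (auto simp: l1_lipschitz_def)

text \<open>\<open>L\<^sub>0\<close> bounds the sample gradients uniformly, and bounded measurable
  functions are integrable for a probability measure.\<close>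

lemma integrable_grad:
  assumes p: "p \<in> domain"
  shows "integrable D (\<lambda>z. grad (\<lambda>q. f q z) p \<bullet> v)"
proof (rule integrable_const_bound)
  show "AE z in D. norm (grad (\<lambda>q. f q z) p \<bullet> v) \<le> L\<^sub>0 * l1norm v"
  proof (rule AE_I2)
    fix z assume z: "z \<in> space D"
    have "norm (grad (\<lambda>q. f q z) p \<bullet> v) \<le> infnorm (grad (\<lambda>q. f q z) p) * l1norm v"
      using inner_le_infnorm_l1norm by simp
    also have "\<dots> \<le> L\<^sub>0 * l1norm v" by (intro mult_right_mono grad_bound p z l1norm_nonneg)
    finally show "norm (grad (\<lambda>q. f q z) p \<bullet> v) \<le> L\<^sub>0 * l1norm v" .
  qed
qed (rule measurable_grad[OF p])

lemma G_inner:
  assumes p: "p \<in> domain"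
  shows "G p \<bullet> v = (\<integral>z. grad (\<lambda>q. f q z) p \<bullet> v \<partial>D)"
proof -
  have "(\<integral>z. grad (\<lambda>q. f q z) p \<bullet> v \<partial>D) = (\<integral>z. (\<Sum>b\<in>Basis. (grad (\<lambda>q. f q z) p \<bullet> b) * (v \<bullet> b)) \<partial>D)"
    by (subst euclidean_inner) simp
  also have "\<dots> = (\<Sum>b\<in>Basis. (\<integral>z. grad (\<lambda>q. f q z) p \<bullet> b \<partial>D) * (v \<bullet> b))"
    using integrable_grad[OF p] by (subst Bochner_Integration.integral_sum) auto
  finally show ?thesis by (simp add: G_def inner_sum_left inner_commute[of v])
qed

lemma abs_integral_le_const:
  assumes int: "integrable D g" and le: "\<And>z. z \<in> space D \<Longrightarrow> \<bar>g z\<bar> \<le> c"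
  shows "\<bar>\<integral>z. g z \<partial>D\<bar> \<le> (c :: real)"
proof -
  have "\<bar>\<integral>z. g z \<partial>D\<bar> \<le> (\<integral>z. \<bar>g z\<bar> \<partial>D)" using integral_norm_bound[of D g] by simp
  also have "\<dots> \<le> c" using int le by (intro integral_le_const) auto
  finally show ?thesis .
qed

lemma G_bound:
  assumes p: "p \<in> domain"
  shows "infnorm (G p) \<le> L\<^sub>0"
proof (rule infnorm_le)
  fix b :: "(real ^ 'n) \<times> (real ^ 'm)" assume b: "b \<in> Basis"
  show "\<bar>G p \<bullet> b\<bar> \<le> L\<^sub>0" unfolding G_inner[OF p]
    using Basis_le_infnorm[OF b] grad_bound[OF p]
    by (intro abs_integral_le_const integrable_grad p) (meson order_trans)
qed

lemma G_lipschitz: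
  assumes p: "p \<in> domain" and p': "p' \<in> domain"
  shows "infnorm (G p - G p') \<le> L\<^sub>1 * l1norm (p - p')"
proof (rule infnorm_le)
  fix b :: "(real ^ 'n) \<times> (real ^ 'm)" assume b: "b \<in> Basis"
  have "(G p - G p') \<bullet> b = (\<integral>z. grad (\<lambda>q. f q z) p \<bullet> b - grad (\<lambda>q. f q z) p' \<bullet> b \<partial>D)"
    using integrable_grad p p' by (simp add: inner_diff_left G_inner)
  also have "\<bar>\<dots>\<bar> \<le> L\<^sub>1 * l1norm (p - p')"
  proof (intro abs_integral_le_const Bochner_Integration.integrable_diff integrable_grad p p')
    fix z assume z: "z \<in> space D"
    have "\<bar>(grad (\<lambda>q. f q z) p - grad (\<lambda>q. f q z) p') \<bullet> b\<bar> \<le> infnorm (grad (\<lambda>q. f q z) p - grad (\<lambda>q. f q z) p')"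
      by (rule Basis_le_infnorm[OF b])
    also have "\<dots> \<le> L\<^sub>1 * l1norm (p - p')" using f_smooth[OF z] p p' by (auto simp: l1_smooth_def)
    finally show "\<bar>grad (\<lambda>q. f q z) p \<bullet> b - grad (\<lambda>q. f q z) p' \<bullet> b\<bar> \<le> L\<^sub>1 * l1norm (p - p')"
      by (simp add: inner_diff_left)
  qed
  finally show "\<bar>(G p - G p') \<bullet> b\<bar> \<le> L\<^sub>1 * l1norm (p - p')" .
qed

text \<open>The quadratic bound holds for each \<open>z\<close> with the same constant, so it
  survives integration.\<close>

lemma F_quadratic_bound:
  assumes u: "u \<in> domain" and u': "u' \<in> domain"
  shows "\<bar>F u' - F u - G u \<bullet> (u' - u)\<bar> \<le> L\<^sub>1 / 2 * (l1norm (u' - u))\<^sup>2"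
proof -
  have "F u' - F u - G u \<bullet> (u' - u) = (\<integral>z. f u' z - f u z - grad (\<lambda>q. f q z) u \<bullet> (u' - u) \<partial>D)"
    using f_integrable[OF u] f_integrable[OF u'] integrable_grad[OF u]
    by (simp add: F_def pop_obj_def G_inner[OF u])
  also have "\<bar>\<dots>\<bar> \<le> L\<^sub>1 / 2 * (l1norm (u' - u))\<^sup>2"
    by (intro abs_integral_le_const Bochner_Integration.integrable_diff f_integrable integrable_grad u u'
      l1_smooth_quadratic_bound[where F = "\<lambda>q. f q z" for z, OF f_smooth convex_domain])
  finally show ?thesis .
qed

lemma
  assumes u: "u \<in> domain" and u': "u' \<in> domain"
  shows F_upper: "F u' \<le> F u + G u \<bullet> (u' - u) + L\<^sub>1 / 2 * (l1norm (u' - u))\<^sup>2"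
    and F_lower: "F u + G u \<bullet> (u' - u) - L\<^sub>1 / 2 * (l1norm (u' - u))\<^sup>2 \<le> F u'"
  using F_quadratic_bound[OF u u'] by linarith+

text \<open>The sign \<open>\<sigma>\<close> covers concavity in \<open>y\<close> (\<open>\<sigma> = 1\<close>) and convexity in \<open>x\<close> (\<open>\<sigma> = - 1\<close>) at once.\<close>

lemma concave_segment_le:
  assumes u: "u \<in> domain" and u': "u' \<in> domain" and \<sigma>: "\<bar>\<sigma>\<bar> = 1"
    and concave: "\<And>s z. 0 \<le> s \<Longrightarrow> s \<le> 1 \<Longrightarrow> z \<in> space D \<Longrightarrow>
      (1 - s) * (\<sigma> * f u z) + s * (\<sigma> * f u' z) \<le> \<sigma> * f ((1 - s) *\<^sub>R u + s *\<^sub>R u') z"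
  shows "\<sigma> * F u' \<le> \<sigma> * F u + \<sigma> * (G u \<bullet> (u' - u))"
proof -
  have "\<sigma> * F u' - \<sigma> * F u \<le> \<sigma> * (G u \<bullet> (u' - u))"
  \<comment> \<open>Concavity bounds the value at \<open>us\<close> from below and the quadratic
    bound limits it from above; after division by \<open>s\<close> the quadratic error vanishes in
    the limit.\<close>
  proof (rule le_of_le_add_small)
    fix s :: real assume s: "0 < s" "s \<le> 1"
    define us where "us = (1 - s) *\<^sub>R u + s *\<^sub>R u'"
    have us: "us \<in> domain" unfolding us_def using convexD_alt[OF convex_domain u u', of s] s by simp
    have d: "us - u = s *\<^sub>R (u' - u)" by (simp add: us_def algebra_simps)
    have "(1 - s) * (\<sigma> * F u) + s * (\<sigma> * F u') = (\<integral>z. (1 - s) * (\<sigma> * f u z) + s * (\<sigma> * f u' z) \<partial>D)"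
      using f_integrable[OF u] f_integrable[OF u'] by (simp add: F_def pop_obj_def)
    also have "\<dots> \<le> (\<integral>z. \<sigma> * f us z \<partial>D)"
      using f_integrable[OF u] f_integrable[OF u'] f_integrable[OF us] concave s
      by (intro integral_mono) (auto simp: us_def)
    also have "\<dots> = \<sigma> * F us" by (simp add: F_def pop_obj_def)
    also have "\<sigma> * F us \<le> \<sigma> * F u + \<sigma> * (G u \<bullet> (us - u)) + L\<^sub>1 / 2 * (l1norm (us - u))\<^sup>2"
    proof -
      have "\<sigma> * (F us - F u - G u \<bullet> (us - u)) \<le> \<bar>\<sigma>\<bar> * \<bar>F us - F u - G u \<bullet> (us - u)\<bar>"
        by (metis abs_ge_self abs_mult)
      thus ?thesis using F_quadratic_bound[OF u us] \<sigma> by (simp add: algebra_simps)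
    qed
    also have "G u \<bullet> (us - u) = s * (G u \<bullet> (u' - u))" by (simp add: d)
    also have "(l1norm (us - u))\<^sup>2 = s\<^sup>2 * (l1norm (u' - u))\<^sup>2"
      by (simp add: d l1norm_scaleR power_mult_distrib)
    finally show "s * (\<sigma> * F u' - \<sigma> * F u) \<le> s * (\<sigma> * (G u \<bullet> (u' - u))) + s\<^sup>2 * (L\<^sub>1 / 2 * (l1norm (u' - u))\<^sup>2)"
      by (simp add: algebra_simps)
  qed
  thus ?thesis by simp
qed

section \<open>The two players and the duality gap\<close>

sublocale max_player: l1_smooth_concave
  "\<lambda>x w. F (x, w)" "\<lambda>x w. fst (G (x, w))" "\<lambda>x w. snd (G (x, w))" L\<^sub>1 L\<^sub>0
proof
  show "0 \<le> L\<^sub>1" by (rule L1_nonneg)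
next
  fix x x' :: "real ^ 'n" and w :: "real ^ 'm"
  assume "x \<in> prob_simplex" "x' \<in> prob_simplex" "w \<in> prob_simplex"
  thus "F (x', w) \<le> F (x, w) + fst (G (x, w)) \<bullet> (x' - x) + L\<^sub>1 / 2 * (l1norm (x' - x))\<^sup>2"
    using F_upper[of "(x, w)" "(x', w)"] by (simp add: inner_prod_def l1norm_Pair)
next
  fix x :: "real ^ 'n" and w w' :: "real ^ 'm"
  assume *: "x \<in> prob_simplex" "w \<in> prob_simplex" "w' \<in> prob_simplex"
  thus "F (x, w) + snd (G (x, w)) \<bullet> (w' - w) - L\<^sub>1 / 2 * (l1norm (w' - w))\<^sup>2 \<le> F (x, w')"
    using F_lower[of "(x, w)" "(x, w')"] by (simp add: inner_prod_def l1norm_Pair)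
  \<comment> \<open>The factors 1 match the sign in \<open>concave_segment_le\<close>. As only
    \<open>w\<close> moves, the inner product reduces to the second component of
    \<open>G\<close>.\<close>
  have "1 * F (x, w') \<le> 1 * F (x, w) + 1 * (G (x, w) \<bullet> ((x, w') - (x, w)))"
  proof (rule concave_segment_le)
    fix s :: real and z assume s: "0 \<le> s" "s \<le> 1" and z: "z \<in> space D"
    have "(1 - s) *\<^sub>R (x, w) + s *\<^sub>R (x, w') = (x, (1 - s) *\<^sub>R w + s *\<^sub>R w')" by (simp add: algebra_simps)
    thus "(1 - s) * (1 * f (x, w) z) + s * (1 * f (x, w') z) \<le> 1 * f ((1 - s) *\<^sub>R (x, w) + s *\<^sub>R (x, w')) z"
      using convex_onD[OF f_concave[OF z *(1), unfolded concave_on_def] s *(2,3)] by simp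
  qed (use * in auto)
  thus "F (x, w') \<le> F (x, w) + snd (G (x, w)) \<bullet> (w' - w)" by (simp add: inner_prod_def)
next
  fix x x' :: "real ^ 'n" and w :: "real ^ 'm"
  assume "x \<in> prob_simplex" "x' \<in> prob_simplex" "w \<in> prob_simplex"
  thus "infnorm (snd (G (x, w)) - snd (G (x', w))) \<le> L\<^sub>1 * l1norm (x - x')"
    using order_trans[OF infnorm_snd_le G_lipschitz[of "(x, w)" "(x', w)"]] by (simp add: l1norm_Pair)
next
  fix x :: "real ^ 'n" and w :: "real ^ 'm"
  assume "x \<in> prob_simplex" "w \<in> prob_simplex"
  thus "infnorm (snd (G (x, w))) \<le> L\<^sub>0"
    using order_trans[OF infnorm_snd_le G_bound[of "(x, w)"]] by simp
qed

text \<open>Negation turns convexity in \<open>x\<close> into concavity and exchanges the upper and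
  lower quadratic bounds.\<close>

sublocale min_player: l1_smooth_concave
  "\<lambda>y v. - F (v, y)" "\<lambda>y v. - snd (G (v, y))" "\<lambda>y v. - fst (G (v, y))" L\<^sub>1 L\<^sub>0
proof
  show "0 \<le> L\<^sub>1" by (rule L1_nonneg)
next
  fix y y' :: "real ^ 'm" and v :: "real ^ 'n"
  assume "y \<in> prob_simplex" "y' \<in> prob_simplex" "v \<in> prob_simplex"
  thus "- F (v, y') \<le> - F (v, y) + - snd (G (v, y)) \<bullet> (y' - y) + L\<^sub>1 / 2 * (l1norm (y' - y))\<^sup>2"
    using F_lower[of "(v, y)" "(v, y')"] by (simp add: inner_prod_def l1norm_Pair)
next
  fix y :: "real ^ 'm" and v v' :: "real ^ 'n"
  assume *: "y \<in> prob_simplex" "v \<in> prob_simplex" "v' \<in> prob_simplex"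
  thus "- F (v, y) + - fst (G (v, y)) \<bullet> (v' - v) - L\<^sub>1 / 2 * (l1norm (v' - v))\<^sup>2 \<le> - F (v', y)"
    using F_upper[of "(v, y)" "(v', y)"] by (simp add: inner_prod_def l1norm_Pair)
  have "(-1) * F (v', y) \<le> (-1) * F (v, y) + (-1) * (G (v, y) \<bullet> ((v', y) - (v, y)))"
  proof (rule concave_segment_le)
    fix s :: real and z assume s: "0 \<le> s" "s \<le> 1" and z: "z \<in> space D"
    have "(1 - s) *\<^sub>R (v, y) + s *\<^sub>R (v', y) = ((1 - s) *\<^sub>R v + s *\<^sub>R v', y)" by (simp add: algebra_simps)
    thus "(1 - s) * (-1 * f (v, y) z) + s * (-1 * f (v', y) z) \<le> -1 * f ((1 - s) *\<^sub>R (v, y) + s *\<^sub>R (v', y)) z"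
      using convex_onD[OF f_convex[OF z *(1)] s *(2,3)] by simp
  qed (use * in auto)
  thus "- F (v', y) \<le> - F (v, y) + - fst (G (v, y)) \<bullet> (v' - v)" by (simp add: inner_prod_def)
next
  fix y y' :: "real ^ 'm" and v :: "real ^ 'n"
  assume "y \<in> prob_simplex" "y' \<in> prob_simplex" "v \<in> prob_simplex"
  thus "infnorm (- fst (G (v, y)) - - fst (G (v, y'))) \<le> L\<^sub>1 * l1norm (y - y')"
    using order_trans[OF infnorm_fst_le G_lipschitz[of "(v, y')" "(v, y)"]]
    by (simp add: l1norm_Pair l1norm_minus_commute)
next
  fix y :: "real ^ 'm" and v :: "real ^ 'n"
  assume "y \<in> prob_simplex" "v \<in> prob_simplex"
  thus "infnorm (- fst (G (v, y))) \<le> L\<^sub>0"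
    using order_trans[OF infnorm_fst_le G_bound[of "(v, y)"]] by (simp add: infnorm_neg)
qed

lemma Gap_eq:
  assumes "p \<in> domain"
  shows "Gap F p = (SUP w\<in>prob_simplex. F (fst p, w)) + (SUP v\<in>prob_simplex. - F (v, snd p))"
proof -
  have p: "fst p \<in> prob_simplex" "snd p \<in> prob_simplex" using assms by auto
  show ?thesis
    using cSUP_add_prod[OF prob_simplex_nonempty prob_simplex_nonempty
      min_player.bdd_above_y[OF p(2)] max_player.bdd_above_y[OF p(1)]]
    by (simp add: Gap_def)
qed

text \<open>The statement conditional on the iterates: \<open>p\<close> is fixed and only the output
  vertices are random. Each player contributes one half through \<open>Gap_eq\<close>.\<close>

lemma expectation_Gap_avg_le:
  assumes N: "0 < N" and p: "\<And>t. t \<in> {1..N} \<Longrightarrow> p t \<in> domain"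
  shows "measure_pmf.expectation (Pi_pmf {1..N} 0 (\<lambda>t. vertex_pair_pmf (p t)))
      (\<lambda>r. Gap F (avg N r) - Gap F (avg N p))
    \<le> 4 * L\<^sub>1 / real N + 2 * L\<^sub>1 * sqrt (ln (real CARD('n)) + ln (real CARD('m))) / sqrt (real N)"
proof -
  define M where "M = Pi_pmf {1..N} 0 (\<lambda>t. vertex_pair_pmf (p t))"
  let ?S1 = "\<lambda>r. SUP w\<in>prob_simplex. F (avg N (\<lambda>t. fst (r t)), w)"
  let ?S2 = "\<lambda>r. SUP v\<in>prob_simplex. - F (v, avg N (\<lambda>t. snd (r t)))"
  define a b where "a = ln (real CARD('n))" and "b = ln (real CARD('m))"
  have ab: "0 \<le> a" "0 \<le> b" by (auto simp: a_def b_def)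
  have finM: "finite (set_pmf M)"
    unfolding M_def using p by (intro finite_set_Pi_pmf finite_set_vertex_pair_pmf) auto
  have int: "integrable (measure_pmf M) k" for k :: "(nat \<Rightarrow> (real ^ 'n) \<times> (real ^ 'm)) \<Rightarrow> real"
    by (rule integrable_measure_pmf_finite[OF finM])
  have Gap_avg: "Gap F (avg N r) = ?S1 r + ?S2 r" if "\<And>t. t \<in> {1..N} \<Longrightarrow> r t \<in> domain" for r
  proof -
    have "avg N r \<in> domain"
      unfolding mem_Times_iff fst_avg snd_avg using that
      by (intro conjI avg_in_prob_simplex N) (auto simp: mem_Times_iff)
    from Gap_eq[OF this] show ?thesis by (simp add: fst_avg snd_avg)
  qed
  have supp: "r t \<in> domain" if "r \<in> set_pmf M" "t \<in> {1..N}" for r t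
    using that set_vertex_pair_pmf[OF p[OF that(2)]] by (auto simp: M_def set_Pi_pmf PiE_dflt_def)
  have vertex: "fst a \<in> prob_simplex" "snd a \<in> prob_simplex"
    if "t \<in> {1..N}" "a \<in> set_pmf (vertex_pair_pmf (p t))" for t a
    using that set_vertex_pair_pmf[OF p[OF that(1)]] by (auto simp: mem_Times_iff)
  have S1: "measure_pmf.expectation M ?S1 \<le> ?S1 p + 2 * L\<^sub>1 / real N + L\<^sub>1 * sqrt (2 * b / real N)"
    unfolding M_def b_def using p vertex
    by (intro max_player.expectation_Sup_avg_le N finite_set_vertex_pair_pmf expectation_vertex_pair_pmf_fst)
       (auto simp: mem_Times_iff)
  have S2: "measure_pmf.expectation M ?S2 \<le> ?S2 p + 2 * L\<^sub>1 / real N + L\<^sub>1 * sqrt (2 * a / real N)"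
    unfolding M_def a_def using p vertex
    by (intro min_player.expectation_Sup_avg_le N finite_set_vertex_pair_pmf expectation_vertex_pair_pmf_snd)
       (auto simp: mem_Times_iff)
  have "measure_pmf.expectation M (\<lambda>r. Gap F (avg N r) - Gap F (avg N p))
      = measure_pmf.expectation M (\<lambda>r. ?S1 r + ?S2 r - (?S1 p + ?S2 p))"
    using Gap_avg[OF supp] Gap_avg[OF p] by (intro expectation_cong_pmf) auto
  also have "\<dots> = measure_pmf.expectation M ?S1 + measure_pmf.expectation M ?S2 - (?S1 p + ?S2 p)"
    by (simp add: int)
  also have "\<dots> \<le> 4 * L\<^sub>1 / real N + L\<^sub>1 * (sqrt (2 * a / real N) + sqrt (2 * b / real N))"
  proof -
    have "4 * L\<^sub>1 / real N = 2 * L\<^sub>1 / real N + 2 * L\<^sub>1 / real N" by simp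
    thus ?thesis using S1 S2 unfolding distrib_left by linarith
  qed
  also have "sqrt (2 * a / real N) + sqrt (2 * b / real N) \<le> 2 * sqrt (a + b) / sqrt (real N)"
  proof -
    \<comment> \<open>The square of a sum is at most twice the sum of squares; this merges the two
      logarithms under one root with the constant 2.\<close>
    have "(sqrt (2 * a) + sqrt (2 * b))\<^sup>2 \<le> 4 * (a + b)"
      using ab sum_squares_bound[of "sqrt (2 * a)" "sqrt (2 * b)"] by (simp add: power2_sum)
    hence "sqrt (2 * a) + sqrt (2 * b) \<le> sqrt (4 * (a + b))" by (rule real_le_rsqrt)
    also have "\<dots> = 2 * sqrt (a + b)" by (subst real_sqrt_mult) simp
    finally have "sqrt (2 * a) + sqrt (2 * b) \<le> 2 * sqrt (a + b)" .
    hence "(sqrt (2 * a) + sqrt (2 * b)) / sqrt (real N) \<le> 2 * sqrt (a + b) / sqrt (real N)"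
      by (intro divide_right_mono) auto
    thus ?thesis by (simp add: real_sqrt_divide add_divide_distrib)
  qed
  finally show ?thesis using L1_nonneg by (simp add: M_def a_def b_def mult_left_mono mult.assoc mult.left_commute[of 2])
qed

end

section \<open>The algorithm\<close>

lemma mw_update_in_prob_simplex:
  fixes x g :: "real ^ 'n"
  assumes "x \<in> prob_simplex"
  shows "mw_update \<tau> x g \<in> prob_simplex"
proof -
  have x: "\<And>i. 0 \<le> x $ i" "(\<Sum>i\<in>UNIV. x $ i) = 1" using assms by (auto simp: prob_simplex_def)
  let ?Z = "\<Sum>i\<in>UNIV. x $ i * exp (- \<tau> * g $ i)"
  \<comment> \<open>Exponentials are positive, so a vanishing normalizer would force all weights to
    vanish, although they sum to one.\<close>
  have "?Z \<noteq> 0"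
  proof
    assume "?Z = 0"
    hence "\<forall>i\<in>UNIV. x $ i * exp (- \<tau> * g $ i) = 0"
      using x by (subst (asm) sum_nonneg_eq_0_iff) auto
    hence "x $ i = 0" for i by simp
    thus False using x by simp
  qed
  moreover have "0 \<le> ?Z" using x by (intro sum_nonneg) auto
  ultimately show ?thesis
    using x by (simp add: prob_simplex_def mw_update_def sum_divide_distrib[symmetric])
qed

text \<open>Membership can be claimed at every position because positions not yet written hold
  \<open>uniform_start\<close>.\<close>

lemma alg_iterates_props:
  "finite (set_pmf (alg_iterates f S \<beta> \<tau> K T)) \<and>
   (\<forall>p\<in>set_pmf (alg_iterates f S \<beta> \<tau> K T). \<forall>t. p t \<in> prob_simplex \<times> prob_simplex)"
proof (induction T)
  case 0
  show ?case by (simp add: uniform_start_def prob_simplex_def)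
next
  case (Suc T)
  have "finite (set_pmf (alg_step f S (\<beta> (Suc T)) \<tau> K q))
      \<and> set_pmf (alg_step f S (\<beta> (Suc T)) \<tau> K q) \<subseteq> prob_simplex \<times> prob_simplex"
    if "q \<in> prob_simplex \<times> prob_simplex" for q
    using that finite_set_vertex_pair_pmf[OF that]
    by (auto simp: alg_step_def Let_def intro!: finite_set_Pi_pmf mw_update_in_prob_simplex)
  note step = this
  show ?case
  proof (intro conjI ballI allI)
    show "finite (set_pmf (alg_iterates f S \<beta> \<tau> K (Suc T)))"
      using Suc step by simp
    fix p t assume "p \<in> set_pmf (alg_iterates f S \<beta> \<tau> K (Suc T))"
    then obtain p0 q where p0: "p0 \<in> set_pmf (alg_iterates f S \<beta> \<tau> K T)"
      and q: "q \<in> set_pmf (alg_step f S (\<beta> (Suc T)) \<tau> K (p0 (Suc T)))"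
      and p: "p = p0(Suc (Suc T) := q)" by auto
    have p0_in: "p0 t \<in> prob_simplex \<times> prob_simplex" for t using Suc p0 by blast
    have "q \<in> prob_simplex \<times> prob_simplex" using step[OF p0_in] q by blast
    thus "p t \<in> prob_simplex \<times> prob_simplex" using p0_in p by simp
  qed
qed

theorem lemma3p9:
  fixes D :: "'z measure"
    and f :: "(real ^ 'n) \<times> (real ^ 'm) \<Rightarrow> 'z \<Rightarrow> real"
    and Q :: "(nat \<Rightarrow> 'z) measure"
    and \<beta> :: "nat \<Rightarrow> nat set"
    and L\<^sub>0 L\<^sub>1 \<tau> :: real
    and n T K :: nat
  assumes D: "prob_space D"
    and f_measurable: "\<And>p. f p \<in> borel_measurable D"
    and f_integrable: "\<And>p. p \<in> prob_simplex \<times> prob_simplex \<Longrightarrow> integrable D (f p)"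
    and f_convex: "\<And>z y. z \<in> space D \<Longrightarrow> y \<in> prob_simplex \<Longrightarrow> convex_on prob_simplex (\<lambda>x. f (x, y) z)"
    and f_concave: "\<And>z x. z \<in> space D \<Longrightarrow> x \<in> prob_simplex \<Longrightarrow> concave_on prob_simplex (\<lambda>y. f (x, y) z)"
    and f_lipschitz: "\<And>z. z \<in> space D
      \<Longrightarrow> l1_lipschitz L\<^sub>0 (\<lambda>p. f p z) (prob_simplex \<times> prob_simplex)"
    and f_smooth: "\<And>z. z \<in> space D
      \<Longrightarrow> l1_smooth L\<^sub>1 (\<lambda>p. f p z) (prob_simplex \<times> prob_simplex)"
    \<comment> \<open>law of the dataset \<open>S\<close> of size \<open>n\<close>\<close>
    and Q: "prob_space Q" "sets Q = sets (\<Pi>\<^sub>M i\<in>{..<n}. D)"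
    \<comment> \<open>\<open>\<beta> t\<close> indexes the fresh batch of size \<open>n / T\<close> used in round \<open>t\<close>\<close>
    and params: "0 < n" "0 < T" "T dvd n" "0 < K" "0 < \<tau>"
    and batches: "\<And>t. t \<in> {1..T} \<Longrightarrow> \<beta> t \<subseteq> {..<n} \<and> card (\<beta> t) = n div T"
                 "disjoint_family_on \<beta> {1..T}"
  shows "(\<integral>S. measure_pmf.expectation (alg_run f S \<beta> \<tau> K T)
             (\<lambda>(p, r). Gap (pop_obj D f) (avg T r) - Gap (pop_obj D f) (avg T p)) \<partial>Q)
         \<le> 4 * L\<^sub>1 / real T
            + 2 * L\<^sub>1 * sqrt (ln (real CARD('n)) + ln (real CARD('m))) / sqrt (real T)"
proof -
  interpret l1_saddle_point_problem D f L\<^sub>0 L\<^sub>1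
    using D f_measurable f_integrable f_convex f_concave f_lipschitz f_smooth
    by (intro l1_saddle_point_problem.intro l1_saddle_point_problem_axioms.intro)
  interpret Q: prob_space Q by (rule Q(1))
  let ?B = "4 * L\<^sub>1 / real T + 2 * L\<^sub>1 * sqrt (ln (real CARD('n)) + ln (real CARD('m))) / sqrt (real T)"
  let ?run = "\<lambda>S. measure_pmf.expectation (alg_run f S \<beta> \<tau> K T)
    (\<lambda>(p, r). Gap (pop_obj D f) (avg T r) - Gap (pop_obj D f) (avg T p))"
  \<comment> \<open>The bound holds for each fixed dataset: it is uniform over the iterates, so
    averaging over them preserves it.\<close>
  have run: "?run S \<le> ?B" for S
  proof -
    let ?I = "alg_iterates f S \<beta> \<tau> K T"
    let ?R = "\<lambda>p. Pi_pmf {1..T} 0 (\<lambda>t. vertex_pair_pmf (p t))"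
    have fin: "finite (set_pmf ?I)"
      and dom: "\<And>p t. p \<in> set_pmf ?I \<Longrightarrow> p t \<in> domain"
      using alg_iterates_props by blast+
    have finR: "finite (set_pmf (?R p))" if "p \<in> set_pmf ?I" for p
      using dom[OF that] by (intro finite_set_Pi_pmf finite_set_vertex_pair_pmf) auto
    have "?run S = measure_pmf.expectation ?I
        (\<lambda>p. measure_pmf.expectation (?R p) (\<lambda>r. Gap F (avg T r) - Gap F (avg T p)))"
      unfolding alg_run_def F_def using fin finR
      by (simp add: expectation_bind_finite_pmf cong: expectation_cong_pmf)
    also have "\<dots> \<le> measure_pmf.expectation ?I (\<lambda>p. ?B)"
      using dom params by (intro expectation_mono_finite_pmf fin expectation_Gap_avg_le) auto
    finally show ?thesis by simp
  qed
  show ?thesis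
  proof (cases "integrable Q ?run")
    case True
    thus ?thesis using run by (intro Q.integral_le_const) auto
  next
    \<comment> \<open>A non-integrable function has Bochner integral 0 by convention, so
      nonnegativity of the bound suffices.\<close>
    case False
    have "0 \<le> ?B" using L1_nonneg by simp
    thus ?thesis by (simp only: not_integrable_integral_eq[OF False])
  qed
qed

end
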